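(* Let $\{\varphi^t\}_{t\ge 0}$ be a smooth dynamical system (with continuous or discrete time) on $U\subseteq\mathbb{R}^n$, and let $K\subset U$ be a nonempty compact invariant set. Let $h:U\to\mathbb{R}^n$ be any diffeomorphism (onto its image $h(U)$), and let $\{\varphi_h^t\}_{t\ge0}$ be the dynamical system on $h(U)$ given by $\varphi_h^t(h(u))=h(\varphi^t(u))$. Then the Lyapunov dimension is invariant under $h$: $$\dim_{\rm L}(\{\varphi^t\}_{t\ge0},K)=\dim_{\rm L}(\{\varphi_h^t\}_{t\ge0},h(K)).$$
   Context: Setting. $U\subseteq\mathbb{R}^n$ is open with the Euclidean norm. A smooth dynamical system $\{\varphi^t\}_{t\ge0}$ on $U$ is one of the following. (Continuous time) $\varphi^t(u_0)=u(t,u_0)$, $t\in[0,\infty)$, where $u(t,u_0)$ is the solution of $\dot u=f(u)$, $u(0,u_0)=u_0$, with $f:U\to\mathbb{R}^n$ continuously differentiable, and it is assumed that for every $u_0\in U$ the solution exists on $[0,\infty)$, is unique and stays in $U$; put $J(u)=Df(u)$. (Discrete time) $\varphi^t$, $t=0,1,2,\dots$, is the $t$-fold iterate of a continuously differentiable map $\varphi:U\to U$, with $\varphi^0={\rm id}$; put $J(u)=D\varphi(u)$. It is assumed that $\det J(u)\ne0$ for all $u\in U$. $D\varphi^t(u)$ denotes the $n\times n$ Jacobian matrix of $\varphi^t$ at $u$. A set $K$ is invariant if $\varphi^t(K)=K$ for all $t>0$. In the discrete case all times $t$ are integers. A diffeomorphism means a bijection onto its image that is continuously differentiable with continuously differentiable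 inverse. All definitions below apply to $\{\varphi_h^t\}_{t\ge0}$ on $h(U)$ as well. Singular value function. For a nonsingular $n\times n$ matrix $A$ with singular values $\sigma_1\ge\dots\ge\sigma_n>0$ and $d\in[0,n]$: $\omega_0(A)=1$; $\omega_d(A)=\sigma_1\cdots\sigma_d$ for $d\in\{1,\dots,n\}$; $\omega_d(A)=\sigma_1\cdots\sigma_{\lfloor d\rfloor}\,\sigma_{\lfloor d\rfloor+1}^{\,d-\lfloor d\rfloor}$ for non-integer $d\in(0,n)$. Lyapunov dimensions. $\dim_{\rm L}(\varphi^t,u)=\inf\{d\in[0,n]:\omega_d(D\varphi^t(u))<1\}$, with the value $n$ if this set is empty; $\dim_{\rm L}(\varphi^t,K)=\sup_{u\in K}\dim_{\rm L}(\varphi^t,u)$; $\dim_{\rm L}(\{\varphi^t\}_{t\ge0},K)=\inf_{t>0}\dim_{\rm L}(\varphi^t,K)$. *)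

theory Defs
  imports "HOL-Analysis.Analysis" "HOL-Computational_Algebra.Polynomial"
begin

definition charpoly :: "real ^ 'n ^ 'n \<Rightarrow> real poly" where
  "charpoly A = det (\<chi> i j. (if i = j then [:0, 1:] else 0) - [:A $ i $ j:])"

text \<open>
  Singular values: square roots of the eigenvalues of \<open>A\<^sup>T A\<close>, repeated according to multiplicity
  and in non-increasing order. That matrix is symmetric and positive semidefinite, so all roots of
  its characteristic polynomial are real and non-negative, and the list has length \<open>CARD('n)\<close>.
\<close>

definition singular_values :: "real ^ 'n ^ 'n \<Rightarrow> real list" where
  "singular_values A =
     rev (sorted_list_of_multiset (image_mset sqrt (proots (charpoly (transpose A ** A)))))"

text \<open>Indexed from 1, so \<open>sigma A 1\<close> is the largest singular value.\<close>

definition sigma :: "real ^ 'n ^ 'n \<Rightarrow> nat \<Rightarrow> real" where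
  "sigma A k = singular_values A ! (k - 1)"

text \<open>Only used for \<open>0 \<le> d \<le> CARD('n)\<close>.\<close>

definition singular_value_function :: "real \<Rightarrow> real ^ 'n ^ 'n \<Rightarrow> real" where
  "singular_value_function d A =
     (let k = nat \<lfloor>d\<rfloor> in
      if d = real k then \<Prod>i=1..k. sigma A i
      else (\<Prod>i=1..k. sigma A i) * sigma A (k + 1) powr (d - real k))"

definition lyapunov_dim_at :: "(real ^ 'n \<Rightarrow> real ^ 'n) \<Rightarrow> real ^ 'n \<Rightarrow> real" where
  "lyapunov_dim_at F u =
     (let D = {d \<in> {0..real CARD('n)}.
                 singular_value_function d (jacobian F (at u)) < 1}
      in if D = {} then real CARD('n) else Inf D)"

definition lyapunov_dim_map :: "(real ^ 'n \<Rightarrow> real ^ 'n) \<Rightarrow> (real ^ 'n) set \<Rightarrow> real" where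
  "lyapunov_dim_map F K = (SUP u\<in>K. lyapunov_dim_at F u)"

text \<open>
  The set \<open>T\<close> of times is \<open>{0..}\<close> for continuous and \<open>\<nat>\<close> for discrete time.
\<close>

definition lyapunov_dim ::
    "real set \<Rightarrow> (real \<Rightarrow> real ^ 'n \<Rightarrow> real ^ 'n) \<Rightarrow> (real ^ 'n) set \<Rightarrow> real" where
  "lyapunov_dim T \<phi> K = (INF t\<in>{t \<in> T. 0 < t}. lyapunov_dim_map (\<phi> t) K)"

text \<open>
  Meant for open \<open>S\<close>; values of \<open>f\<close> outside \<open>S\<close> are then irrelevant.
\<close>

definition continuously_differentiable_on ::
    "(real ^ 'n) set \<Rightarrow> (real ^ 'n \<Rightarrow> real ^ 'n) \<Rightarrow> bool" where
  "continuously_differentiable_on S f \<longleftrightarrow>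
     (\<forall>x\<in>S. f differentiable (at x)) \<and>
     continuous_on S (\<lambda>x. jacobian f (at x))"

text \<open>
  For open \<open>U\<close> the image \<open>h ` U\<close> is open by invariance of domain, so full derivatives are
  the right notion for the inverse as well.
\<close>

definition diffeomorphism_on ::
    "(real ^ 'n) set \<Rightarrow> (real ^ 'n \<Rightarrow> real ^ 'n) \<Rightarrow> bool" where
  "diffeomorphism_on U h \<longleftrightarrow>
     inj_on h U \<and> continuously_differentiable_on U h \<and>
     continuously_differentiable_on (h ` U) (inv_into U h)"

definition forward_solution ::
    "(real ^ 'n) set \<Rightarrow> (real ^ 'n \<Rightarrow> real ^ 'n) \<Rightarrow> real ^ 'n \<Rightarrow> (real \<Rightarrow> real ^ 'n) \<Rightarrow> bool" where
  "forward_solution U f u0 u \<longleftrightarrow>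
     u 0 = u0 \<and>
     (\<forall>t\<ge>0. u t \<in> U \<and> (u has_vector_derivative f (u t)) (at t within {0..}))"

definition continuous_time_system ::
    "(real ^ 'n) set \<Rightarrow> (real \<Rightarrow> real ^ 'n \<Rightarrow> real ^ 'n) \<Rightarrow> bool" where
  "continuous_time_system U \<phi> \<longleftrightarrow>
     (\<exists>f. continuously_differentiable_on U f \<and>
          (\<forall>u\<in>U. det (jacobian f (at u)) \<noteq> 0) \<and>
          (\<forall>u0\<in>U. forward_solution U f u0 (\<lambda>t. \<phi> t u0) \<and>
             (\<forall>v. forward_solution U f u0 v \<longrightarrow> (\<forall>t\<ge>0. v t = \<phi> t u0))))"

definition discrete_time_system ::
    "(real ^ 'n) set \<Rightarrow> (real \<Rightarrow> real ^ 'n \<Rightarrow> real ^ 'n) \<Rightarrow> bool" where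
  "discrete_time_system U \<phi> \<longleftrightarrow>
     (\<exists>g. continuously_differentiable_on U g \<and> g ` U \<subseteq> U \<and>
          (\<forall>u\<in>U. det (jacobian g (at u)) \<noteq> 0) \<and>
          (\<forall>k. \<forall>u\<in>U. \<phi> (real k) u = (g ^^ k) u))"

definition smooth_dynamical_system ::
    "(real ^ 'n) set \<Rightarrow> real set \<Rightarrow> (real \<Rightarrow> real ^ 'n \<Rightarrow> real ^ 'n) \<Rightarrow> bool" where
  "smooth_dynamical_system U T \<phi> \<longleftrightarrow>
     open U \<and>
     (T = {0..} \<and> continuous_time_system U \<phi> \<or> T = \<nat> \<and> discrete_time_system U \<phi>)"

definition invariant_set ::
    "real set \<Rightarrow> (real \<Rightarrow> real ^ 'n \<Rightarrow> real ^ 'n) \<Rightarrow> (real ^ 'n) set \<Rightarrow> bool" where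
  "invariant_set T \<phi> K \<longleftrightarrow> (\<forall>t\<in>T. 0 < t \<longrightarrow> \<phi> t ` K = K)"

end

(*
  The chain rule gives D phi_h^t (h u) = Dh (phi^t u) D phi^t (u) (Dh u)^(-1), so submultiplicativity
  of the singular value function omega_d shows that omega_d changes at most by a factor C that is
  independent of t, because Dh and its inverse are bounded on the compact sets K and h(K). If d
  exceeds the Lyapunov dimension of phi, then for some t > 0, by compactness of K and continuity of
  D phi^t, omega_d (D phi^t) <= q < 1 on K; the cocycle property gives omega_d (D phi^(m t)) <= q^m,
  which beats C for large m. Hence the dimension of phi_h is at most d, and the roles of the two
  systems can be exchanged.
*)
theory Submission
  imports Defs
begin

section \<open>The spectral theorem and singular values\<close>

text \<open>The obstacle is that \<open>sigma\<close> is defined through the roots of a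
  characteristic polynomial, which says nothing directly about products or perturbations of
  matrices. A basis of right singular vectors translates it into geometry: prefix products of
  \<open>sigma\<close> become extremal stretching factors of volume, measured by Gram determinants
  in place of exterior powers, and single values satisfy a Weyl inequality, hence are continuous.
  For fractional d, omega_d is a weighted geometric mean of the two neighbouring integer cases and
  so inherits submultiplicativity. As omega_d is not monotone in d, the infimum in the dimension is
  controlled through the upward closedness of the set of d with omega_d < 1. In continuous time the
  definition only provides orbits of a C^1 vector field; that the time-t map is differentiable on K,
  with continuous Jacobian, has to be derived, and Gronwall estimates around orbits that stay in K
  supply it.\<close>

lemma symmetric_matrix_inner:
  fixes S :: "real^'n^'n"
  assumes "transpose S = S"
  shows "x \<bullet> (S *v y) = (S *v x) \<bullet> y"
  by (metis assms dot_lmul_matrix matrix_transpose_mul transpose_transpose vector_transpose_matrix)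

text \<open>A maximiser \<open>e\<close> of the quadratic form on the unit sphere of
  \<open>W\<close> works. The residual \<open>w\<close> of the eigenvector equation lies in
  \<open>W\<close> by invariance, and unless it vanishes, moving \<open>e\<close> against
  \<open>w\<close> would raise the Rayleigh quotient above its maximum.\<close>

lemma symmetric_eigenvector_in_subspace:
  fixes S :: "real^'n^'n"
  assumes sym: "transpose S = S" and W: "subspace W" and inv: "\<And>x. x \<in> W \<Longrightarrow> S *v x \<in> W"
    and nz: "\<exists>x\<in>W. x \<noteq> 0"
  obtains e l where "e \<in> W" "norm e = 1" "S *v e = l *\<^sub>R e"
proof -
  let ?q = "\<lambda>x. x \<bullet> (S *v x)"
  let ?C = "sphere 0 1 \<inter> W"
  have "compact ?C" using W closed_subspace by (intro compact_Int_closed) auto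
  moreover have "?C \<noteq> {}"
  proof -
    obtain x where "x \<in> W" "x \<noteq> 0" using nz by auto
    hence "(1 / norm x) *\<^sub>R x \<in> ?C" using W by (auto simp: subspace_scale)
    thus ?thesis by blast
  qed
  moreover have "continuous_on ?C ?q"
    by (intro continuous_intros)
  ultimately obtain e where e: "e \<in> ?C" and max: "\<And>x. x \<in> ?C \<Longrightarrow> ?q x \<le> ?q e"
    using continuous_attains_sup[of ?C ?q] by metis
  define l where "l = ?q e"
  have ne: "norm e = 1" and eW: "e \<in> W" using e by auto
  have qle: "?q x \<le> l * (x \<bullet> x)" if "x \<in> W" for x
  proof (cases "x = 0")
    case False
    have "(1 / norm x) *\<^sub>R x \<in> ?C" using False W that by (auto simp: subspace_scale)
    from max[OF this] have "?q x / (norm x * norm x) \<le> l"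
      by (simp add: l_def matrix_vector_mult_scaleR)
    thus ?thesis using False by (simp add: divide_le_eq power2_norm_eq_inner[symmetric] power2_eq_square)
  qed simp
  define w where "w = l *\<^sub>R e - S *v e"
  have wW: "w \<in> W" unfolding w_def using eW W inv by (simp add: subspace_diff subspace_scale)
  define b where "b = w \<bullet> w"
  define c where "c = l * (w \<bullet> w) - ?q w"
  have c0: "c \<ge> 0" using qle[OF wW] by (simp add: c_def)
  have *: "2 * t * b + t^2 * c \<ge> 0" for t
  proof -
    have "e + t *\<^sub>R w \<in> W" using eW wW W by (simp add: subspace_add subspace_scale)
    from qle[OF this] have "0 \<le> l * ((e + t *\<^sub>R w) \<bullet> (e + t *\<^sub>R w)) - ?q (e + t *\<^sub>R w)" by simp
    also have "e \<bullet> (S *v w) = w \<bullet> (S *v e)"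
      using symmetric_matrix_inner[OF sym, of e w] by (simp add: inner_commute)
    hence "l * ((e + t *\<^sub>R w) \<bullet> (e + t *\<^sub>R w)) - ?q (e + t *\<^sub>R w)
        = l * (e \<bullet> e) - ?q e + 2 * t * (l * (e \<bullet> w) - w \<bullet> (S *v e)) + t^2 * c"
      by (simp add: c_def inner_add_left inner_add_right matrix_vector_right_distrib
          matrix_vector_mult_scaleR algebra_simps power2_eq_square inner_commute)
    also have "e \<bullet> e = 1" using ne by (simp add: power2_norm_eq_inner[symmetric])
    also have "l * (e \<bullet> w) - w \<bullet> (S *v e) = b"
      unfolding b_def by (subst (2) w_def) (simp add: inner_diff_right inner_commute)
    finally show ?thesis by (simp add: l_def)
  qed
  have "b = 0"
  proof (rule ccontr)
    assume "b \<noteq> 0"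
    hence b: "b > 0" by (simp add: b_def)
    \<comment> \<open>The denominator \<open>c\<close> would give the minimiser of the quadratic,
      but \<open>c\<close> may be 0. With \<open>c + 1\<close> the quadratic collapses to
      \<open>t * b - t^2\<close>, which is negative.\<close>
    define t where "t = - b / (c + 1)"
    have "t * c = - b - t" using c0 by (simp add: t_def field_simps)
    hence "2 * t * b + t^2 * c = t * b - t^2"
      by (simp add: power2_eq_square mult.assoc) (simp add: algebra_simps)
    also have "t * b < 0" using b c0 by (simp add: t_def divide_neg_pos mult_neg_pos)
    hence "t * b - t^2 < 0" by (smt (verit) zero_le_power2)
    finally show False using *[of t] by simp
  qed
  hence "S *v e = l *\<^sub>R e" by (simp add: b_def w_def)
  thus ?thesis using that eW ne by blast
qed

text \<open>Take an orthonormal set of eigenvectors of maximal size; sizes are bounded by the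
  dimension. By symmetry its orthogonal complement is invariant under \<open>S\<close>, so if it
  were nonzero it would contain one more eigenvector.\<close>

lemma symmetric_orthonormal_eigenbasis:
  fixes S :: "real^'n^'n"
  assumes sym: "transpose S = S"
  obtains b :: "'n \<Rightarrow> real^'n" and d
  where "\<And>i j. b i \<bullet> b j = (if i = j then 1 else 0)" "\<And>i. S *v b i = d i *\<^sub>R b i"
proof -
  define P where "P B \<longleftrightarrow> pairwise orthogonal B \<and> (\<forall>x\<in>B. norm x = 1 \<and> (\<exists>l. S *v x = l *\<^sub>R x))"
    for B :: "(real^'n) set"
  have ind: "independent B" if "P B" for B
    using that pairwise_orthogonal_independent[of B] by (force simp: P_def)
  have bnd: "card B \<le> CARD('n)" if "P B" for B
    using independent_bound[OF ind[OF that]] by simp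
  have "P {}" by (simp add: P_def)
  then obtain B where B: "P B" and mx: "\<And>B'. P B' \<Longrightarrow> card B' \<le> card B"
    using ex_has_greatest_nat[of P "{}" card "Suc CARD('n)"] bnd by (metis le_imp_less_Suc)
  have fB: "finite B" using ind[OF B] independent_imp_finite by blast
  define W where "W = {w. \<forall>x\<in>B. x \<bullet> w = 0}"
  have subW: "subspace W" by (auto simp: W_def subspace_def inner_add_right)
  have W0: "W = {0}"
  proof (rule ccontr)
    assume "W \<noteq> {0}"
    hence nz: "\<exists>x\<in>W. x \<noteq> 0" using subspace_0[OF subW] by auto
    have "S *v w \<in> W" if w: "w \<in> W" for w
      unfolding W_def
    proof safe
      fix x assume x: "x \<in> B"
      then obtain l where "S *v x = l *\<^sub>R x" using B by (auto simp: P_def)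
      thus "x \<bullet> (S *v w) = 0" using w x
        by (simp add: symmetric_matrix_inner[OF sym] W_def)
    qed
    from symmetric_eigenvector_in_subspace[OF sym subW this nz]
    obtain e l where e: "e \<in> W" "norm e = 1" "S *v e = l *\<^sub>R e" by auto
    have "e \<notin> B" using e by (auto simp: W_def)
    moreover have "P (insert e B)"
      using B e by (auto simp: P_def pairwise_insert W_def orthogonal_def inner_commute)
    ultimately show False using mx[of "insert e B"] fB by simp
  qed
  have "dim (span B) = CARD('n)"
  proof -
    have "W = {y \<in> UNIV. \<forall>x\<in>span B. orthogonal x y}"
      using orthogonal_to_span[of _ B] unfolding W_def orthogonal_def
      by (force simp: inner_commute span_base)
    hence "dim W + dim (span B) = dim (UNIV :: (real^'n) set)"
      using dim_subspace_orthogonal_to_vectors[of "span B" UNIV] by simp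
    thus ?thesis using W0 by simp
  qed
  hence "card B = CARD('n)" using ind[OF B] by (simp add: dim_eq_card_independent)
  then obtain b where b: "bij_betw b (UNIV :: 'n set) B"
    using finite_same_card_bij[of "UNIV :: 'n set" B] fB by auto
  have "b i \<bullet> b j = (if i = j then 1 else 0)" for i j
  proof -
    have "b i \<in> B" "b j \<in> B" "b i = b j \<longleftrightarrow> i = j"
      using b by (auto simp: bij_betw_def inj_def)
    moreover have "b i \<bullet> b i = 1"
      using \<open>b i \<in> B\<close> B by (simp add: P_def power2_norm_eq_inner[symmetric])
    ultimately show ?thesis using B by (auto simp: P_def pairwise_def orthogonal_def)
  qed
  moreover have "\<exists>l. S *v b i = l *\<^sub>R b i" for i
    using B b by (auto simp: P_def bij_betw_def)
  hence "\<And>i. S *v b i = (SOME l. S *v b i = l *\<^sub>R b i) *\<^sub>R b i" by (rule someI_ex)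
  ultimately show ?thesis by (rule that)
qed

text \<open>For the matrix \<open>Q\<close> with rows \<open>b i\<close>, orthonormality says that
  \<open>transpose Q\<close> is a right inverse. For square matrices it is then a left inverse too,
  and that product is the expansion.\<close>

lemma orthonormal_expansion:
  fixes b :: "'n \<Rightarrow> real^'n"
  assumes on: "\<And>i j. b i \<bullet> b j = (if i = j then 1 else 0)"
  shows "x = (\<Sum>i\<in>UNIV. (x \<bullet> b i) *\<^sub>R b i)"
proof -
  define Q where "Q = (\<chi> i. b i)"
  have "Q ** transpose Q = mat 1"
    by (auto simp: Q_def matrix_matrix_mult_def transpose_def mat_def vec_eq_iff
        on[unfolded inner_vec_def, simplified])
  hence "transpose Q ** Q = mat 1" using matrix_left_right_inverse by blast
  hence "x = transpose Q *v (Q *v x)" by (simp add: matrix_vector_mul_assoc)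
  also have "\<dots> = (\<Sum>i\<in>UNIV. (x \<bullet> b i) *\<^sub>R b i)"
    by (simp add: vec_eq_iff Q_def matrix_vector_mult_def transpose_def inner_vec_def mult.commute)
  finally show ?thesis .
qed

lemma poly_det:
  fixes M :: "real poly^'n^'n"
  shows "poly (det M) x = det (\<chi> i j. poly (M $ i $ j) x)"
  by (simp add: det_def poly_sum poly_prod)

text \<open>Eigenvectors as columns conjugate x - S to a diagonal matrix. The product form keeps the
  multiplicities, which the list of singular values counts.\<close>

lemma charpoly_eigenbasis:
  fixes S :: "real^'n^'n" and b :: "'n \<Rightarrow> real^'n"
  assumes on: "\<And>i j. b i \<bullet> b j = (if i = j then 1 else 0)"
    and ev: "\<And>i. S *v b i = d i *\<^sub>R b i"
  shows "charpoly S = (\<Prod>i\<in>UNIV. [:- d i, 1:])"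
proof (subst poly_eq_poly_eq_iff[symmetric], rule ext)
  fix x
  define Q where "Q = (\<chi> i. b i)"
  define D :: "real^'n^'n" where "D = (\<chi> i j. if i = j then x - d i else 0)"
  define M where "M = (\<chi> i j. (if i = j then x else 0) - S $ i $ j)"
  have QQ: "Q ** transpose Q = mat 1"
    by (auto simp: Q_def matrix_matrix_mult_def transpose_def mat_def vec_eq_iff
        on[unfolded inner_vec_def, simplified])
  have Mv: "M *v v = x *\<^sub>R v - S *v v" for v
    by (simp add: M_def vec_eq_iff matrix_vector_mult_def left_diff_distrib sum_subtractf
        if_distrib[of "\<lambda>t. t * _"] cong: if_cong)
  have "(M *v b j) $ i = (x - d j) * b j $ i" for i j
    by (simp add: Mv ev left_diff_distrib)
  hence "M ** transpose Q = transpose Q ** D"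
    by (simp add: vec_eq_iff matrix_matrix_mult_def transpose_def Q_def D_def matrix_vector_mult_def
        if_distrib[of "\<lambda>t. _ * t"] mult.commute cong: if_cong)
  hence "det M * det Q = det Q * det D"
    by (metis det_mul det_transpose)
  moreover have "det Q \<noteq> 0"
    using QQ by (metis det_I det_mul mult_zero_left zero_neq_one)
  ultimately have "det M = det D" by simp
  also have "\<dots> = (\<Prod>i\<in>UNIV. x - d i)"
    unfolding D_def by (subst det_diagonal) auto
  finally have "det M = (\<Prod>i\<in>UNIV. x - d i)" .
  moreover have "poly (charpoly S) x = det M"
    unfolding charpoly_def poly_det M_def
    by (rule arg_cong[of _ _ det]) (simp add: vec_eq_iff)
  ultimately show "poly (charpoly S) x = poly (\<Prod>i\<in>UNIV. [:- d i, 1:]) x"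
    by (simp add: poly_prod)
qed

text \<open>The bridge from the algebraic definition of \<open>sigma\<close> to geometry. The
  \<open>b i\<close> are right singular vectors, numbered from 0 so that \<open>b i\<close> belongs
  to \<open>sigma A (Suc i)\<close>.\<close>

lemma singular_value_basis:
  fixes A :: "real^'n^'n"
  obtains b :: "nat \<Rightarrow> real^'n"
  where "\<And>i j. i < CARD('n) \<Longrightarrow> j < CARD('n) \<Longrightarrow> b i \<bullet> b j = (if i = j then 1 else 0)"
    and "\<And>x y. (A *v x) \<bullet> (A *v y) = (\<Sum>i<CARD('n). (sigma A (Suc i))\<^sup>2 * (x \<bullet> b i) * (y \<bullet> b i))"
    and "\<And>x y. x \<bullet> y = (\<Sum>i<CARD('n). (x \<bullet> b i) * (y \<bullet> b i))"
    and "\<And>i. i < CARD('n) \<Longrightarrow> 0 \<le> sigma A (Suc i)"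
    and "\<And>i j. i \<le> j \<Longrightarrow> j < CARD('n) \<Longrightarrow> sigma A (Suc j) \<le> sigma A (Suc i)"
proof -
  let ?S = "transpose A ** A"
  let ?n = "CARD('n)"
  have "transpose ?S = ?S" by (simp add: matrix_transpose_mul)
  then obtain b :: "'n \<Rightarrow> real^'n" and d where on: "\<And>i j. b i \<bullet> b j = (if i = j then 1 else 0)"
    and ev: "\<And>i. ?S *v b i = d i *\<^sub>R b i"
    by (rule symmetric_orthonormal_eigenbasis) blast
  have AA: "(A *v x) \<bullet> (A *v y) = x \<bullet> (?S *v y)" for x y
    by (metis dot_lmul_matrix matrix_vector_mul_assoc transpose_matrix_vector inner_commute)
  have d0: "0 \<le> d i" for i
  proof -
    have "d i = b i \<bullet> (?S *v b i)" using ev on by simp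
    also have "\<dots> \<ge> 0" by (simp add: AA[symmetric])
    finally show ?thesis .
  qed
  have pr: "proots (charpoly ?S) = image_mset d (mset_set UNIV)"
  proof -
    have "proots (charpoly ?S) = (\<Sum>i\<in>UNIV. {#d i#})"
      unfolding charpoly_eigenbasis[OF on ev] by (subst proots_prod) auto
    also have "\<dots> = image_mset d (mset_set UNIV)"
      by (simp add: sum_unfold_sum_mset sum_mset_singleton_mset)
    finally show ?thesis .
  qed
  obtain xs where xs: "set xs = (UNIV::'n set)" "distinct xs"
    using finite_distinct_list[OF finite_class.finite_UNIV] by auto
  \<comment> \<open>Sorting the indices instead of the values keeps every value attached to its
    eigenvector.\<close>
  define ys where "ys = rev (sort_key (\<lambda>i. sqrt (d i)) xs)"
  have ys: "set ys = UNIV" "distinct ys" using xs by (auto simp: ys_def)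
  hence len: "length ys = ?n" by (metis distinct_card)
  have sv: "singular_values A = map (\<lambda>i. sqrt (d i)) ys"
  proof -
    have "mset_set UNIV = mset xs" using xs by (metis mset_set_set)
    hence "image_mset sqrt (proots (charpoly ?S)) = mset (map (\<lambda>i. sqrt (d i)) xs)"
      by (simp add: pr image_mset.compositionality o_def)
    moreover have "sorted_list_of_multiset (mset (map (\<lambda>i. sqrt (d i)) xs)) = map (\<lambda>i. sqrt (d i)) (sort_key (\<lambda>i. sqrt (d i)) xs)"
      unfolding sorted_list_of_multiset_mset by (rule properties_for_sort) simp_all
    ultimately show ?thesis by (simp add: singular_values_def ys_def rev_map)
  qed
  have sg: "sigma A (Suc i) = sqrt (d (ys ! i))" if "i < ?n" for i
    using that len by (simp add: sigma_def sv)
  have bij: "bij_betw ((!) ys) {..<?n} UNIV"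
    using ys len by (metis bij_betw_nth)
  show ?thesis
  proof (rule that[of "\<lambda>i. b (ys ! i)"])
    fix i j assume "i < ?n" "j < ?n"
    thus "b (ys ! i) \<bullet> b (ys ! j) = (if i = j then 1 else 0)"
      using ys len by (simp add: on nth_eq_iff_index_eq)
  next
    fix x y
    have "(A *v x) \<bullet> (A *v y) = x \<bullet> (?S *v (\<Sum>i\<in>UNIV. (y \<bullet> b i) *\<^sub>R b i))"
      by (subst orthonormal_expansion[OF on, of y, symmetric]) (rule AA)
    also have "\<dots> = (\<Sum>i\<in>UNIV. d i * (x \<bullet> b i) * (y \<bullet> b i))"
      by (simp add: linear_sum[OF matrix_vector_mul_linear] matrix_vector_mult_scaleR ev
          inner_sum_right mult_ac)
    also have "\<dots> = (\<Sum>i<?n. d (ys!i) * (x \<bullet> b (ys!i)) * (y \<bullet> b (ys!i)))"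
      by (rule sum.reindex_bij_betw[OF bij, symmetric])
    also have "\<dots> = (\<Sum>i<?n. (sigma A (Suc i))\<^sup>2 * (x \<bullet> b (ys!i)) * (y \<bullet> b (ys!i)))"
      by (rule sum.cong) (auto simp: sg d0)
    finally show "(A *v x) \<bullet> (A *v y) = \<dots>" .
  next
    fix x y
    have "x \<bullet> y = x \<bullet> (\<Sum>i\<in>UNIV. (y \<bullet> b i) *\<^sub>R b i)"
      by (subst orthonormal_expansion[OF on, of y, symmetric]) (rule refl)
    also have "\<dots> = (\<Sum>i\<in>UNIV. (x \<bullet> b i) * (y \<bullet> b i))"
      by (simp add: inner_sum_right mult_ac)
    also have "\<dots> = (\<Sum>i<?n. (x \<bullet> b (ys!i)) * (y \<bullet> b (ys!i)))"
      by (rule sum.reindex_bij_betw[OF bij, symmetric])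
    finally show "x \<bullet> y = \<dots>" .
  next
    fix i assume "i < ?n" thus "0 \<le> sigma A (Suc i)" by (simp add: sg d0)
  next
    fix i j assume ij: "i \<le> j" "j < ?n"
    have "sorted (rev (map (\<lambda>i. sqrt (d i)) ys))"
      by (simp add: ys_def rev_map[symmetric])
    hence "sqrt (d (ys!j)) \<le> sqrt (d (ys!i))"
      using sorted_rev_nth_mono[of "map (\<lambda>i. sqrt (d i)) ys" i j] ij len by simp
    thus "sigma A (Suc j) \<le> sigma A (Suc i)" using ij by (simp add: sg)
  qed
qed

section \<open>Volume growth and submultiplicativity\<close>

text \<open>The determinant of a leading square block. For \<open>det\<close> the size is a type,
  whereas here it is a number \<open>k\<close> that varies within proofs.\<close>

definition leibniz_det :: "nat \<Rightarrow> (nat \<Rightarrow> nat \<Rightarrow> real) \<Rightarrow> real" where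
  "leibniz_det k m = (\<Sum>p | p permutes {..<k}. of_int (sign p) * (\<Prod>i<k. m i (p i)))"

lemma leibniz_det_permute_rows:
  assumes q: "q permutes {..<k}"
  shows "leibniz_det k (\<lambda>i. m (q i)) = of_int (sign q) * leibniz_det k m"
proof -
  have "leibniz_det k (\<lambda>i. m (q i))
      = (\<Sum>p | p permutes {..<k}. of_int (sign (p \<circ> q)) * (\<Prod>i<k. m (q i) (p (q i))))"
    unfolding leibniz_det_def by (subst sum_permutations_compose_right[OF q]) simp
  also have "\<dots> = (\<Sum>p | p permutes {..<k}. of_int (sign q) * (of_int (sign p) * (\<Prod>i<k. m i (p i))))"
  proof (rule sum.cong[OF refl])
    fix p assume "p \<in> {p. p permutes {..<k}}"
    hence "permutation p" "permutation q" using q by (auto intro: permutes_imp_permutation[OF finite_lessThan])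
    moreover have "(\<Prod>i<k. m i (p i)) = (\<Prod>i<k. m (q i) (p (q i)))"
      by (rule prod.permute[OF q, of "\<lambda>i. m i (p i)", unfolded o_def])
    ultimately show "of_int (sign (p \<circ> q)) * (\<Prod>i<k. m (q i) (p (q i)))
        = of_int (sign q) * (of_int (sign p) * (\<Prod>i<k. m i (p i)))"
      by (simp add: sign_compose)
  qed
  finally show ?thesis by (simp add: leibniz_det_def sum_distrib_left)
qed

text \<open>Swapping the two rows changes nothing but has sign -1, so the determinant equals its own
  negative.\<close>

lemma leibniz_det_equal_rows:
  assumes "i < k" "j < k" "i \<noteq> j" "m i = m j"
  shows "leibniz_det k m = 0"
proof -
  let ?t = "Transposition.transpose i j"
  have t: "?t permutes {..<k}" using assms by (intro permutes_swap_id) auto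
  have "m (?t l) = m l" for l using assms(4) by (cases "l = i"; cases "l = j") simp_all
  hence "(\<lambda>l. m (?t l)) = m" by blast
  thus ?thesis using leibniz_det_permute_rows[OF t, of m] assms by (simp add: sign_swap_id)
qed

lemma leibniz_det_scale_rows:
  "leibniz_det k (\<lambda>i j. c i * m i j) = (\<Prod>i<k. c i) * leibniz_det k m"
  by (simp add: leibniz_det_def prod.distrib sum_distrib_left mult_ac)

lemma leibniz_det_diagonal:
  assumes "\<And>i j. i < k \<Longrightarrow> j < k \<Longrightarrow> i \<noteq> j \<Longrightarrow> m i j = 0"
  shows "leibniz_det k m = (\<Prod>i<k. m i i)"
proof -
  have "(\<Prod>i<k. m i (p i)) = 0" if p: "p permutes {..<k}" "p \<noteq> id" for p
  proof -
    obtain i where i: "p i \<noteq> i" using p by (auto simp: fun_eq_iff)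
    hence "i < k" using p permutes_not_in[of p "{..<k}" i] by auto
    moreover from this have "p i < k" using p permutes_in_image[of p "{..<k}" i] by auto
    ultimately show ?thesis using assms[of i "p i"] i by auto
  qed
  hence "leibniz_det k m = (\<Sum>p\<in>{id}. of_int (sign p) * (\<Prod>i<k. m i (p i)))"
    unfolding leibniz_det_def
    by (intro sum.mono_neutral_right) (auto simp: finite_permutations permutes_id)
  thus ?thesis by simp
qed

lemma sum_PiE_permute:
  assumes q: "q permutes A"
  shows "(\<Sum>f\<in>PiE A (\<lambda>_. S). g (f \<circ> q)) = (\<Sum>f\<in>PiE A (\<lambda>_. S). g f)"
proof (rule sum.reindex_bij_witness[of _ "\<lambda>f. f \<circ> inv q" "\<lambda>f. f \<circ> q"])
  have mem: "f \<circ> r \<in> PiE A (\<lambda>_. S)" if "f \<in> PiE A (\<lambda>_. S)" "r permutes A" for f r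
    using that permutes_in_image[OF that(2)] permutes_not_in[OF that(2)]
    by (auto simp: PiE_def extensional_def Pi_def)
  show "f \<circ> q \<in> PiE A (\<lambda>_. S)" if "f \<in> PiE A (\<lambda>_. S)" for f using mem[OF that q] .
  show "f \<circ> inv q \<in> PiE A (\<lambda>_. S)" if "f \<in> PiE A (\<lambda>_. S)" for f
    using mem[OF that permutes_inv[OF q]] .
qed (use permutes_inv_o[OF q] in \<open>auto simp: o_assoc[symmetric]\<close>)

text \<open>The discrete Andreief identity: Cauchy-Binet with the sum over all index maps
  \<open>f\<close> instead of subsets of size \<open>k\<close>. Every subset is then counted once
  for each of its orderings, which is the factor \<open>fact k\<close>, and maps that are not
  injective contribute 0.\<close>

lemma andreief_identity:
  assumes S: "finite S"
  shows "fact k * leibniz_det k (\<lambda>i j. \<Sum>a\<in>S. x i a * y j a)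
    = (\<Sum>f\<in>PiE {..<k} (\<lambda>_. S). leibniz_det k (\<lambda>i j. x j (f i)) * leibniz_det k (\<lambda>i j. y j (f i)))"
proof -
  let ?P = "{p. p permutes {..<k}}" and ?F = "PiE {..<k} (\<lambda>_. S)"
  define Y where "Y f = leibniz_det k (\<lambda>i j. y j (f i))" for f
  define X where "X f = leibniz_det k (\<lambda>i j. x j (f i))" for f
  define L where "L = leibniz_det k (\<lambda>i j. \<Sum>a\<in>S. x i a * y j a)"
  have "L = (\<Sum>p\<in>?P. of_int (sign p) * (\<Sum>f\<in>?F. \<Prod>i<k. x i (f i) * y (p i) (f i)))"
    unfolding L_def leibniz_det_def using S by (subst prod_sum_PiE) auto
  also have "\<dots> = (\<Sum>f\<in>?F. (\<Prod>i<k. x i (f i)) * Y f)"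
    unfolding Y_def leibniz_det_def
    by (simp add: sum_distrib_left prod.distrib mult_ac sum.swap[of _ ?F])
  finally have L: "L = (\<Sum>f\<in>?F. (\<Prod>i<k. x i (f i)) * Y f)" .
  \<comment> \<open>Substituting \<open>f \<circ> q\<close> for \<open>f\<close> permutes the rows
    of \<open>Y f\<close> and costs the sign of \<open>q\<close>. Adding the resulting expressions
    for \<open>L\<close> over all \<open>q\<close> assembles the second determinant
    \<open>X f\<close>.\<close>
  have Lq: "L = (\<Sum>f\<in>?F. of_int (sign q) * (\<Prod>i<k. x i (f (q i))) * Y f)" if q: "q permutes {..<k}" for q
  proof -
    have "Y (f \<circ> q) = of_int (sign q) * Y f" for f
      unfolding Y_def using leibniz_det_permute_rows[OF q, of "\<lambda>i j. y j (f i)"] by simp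
    thus ?thesis
      unfolding L by (subst sum_PiE_permute[OF q, symmetric]) (simp add: mult_ac)
  qed
  \<comment> \<open>Invariance of the determinant under transposition, by passing to inverse
    permutations.\<close>
  have XX: "(\<Sum>q\<in>?P. of_int (sign q) * (\<Prod>i<k. x i (f (q i)))) = X f" for f
  proof -
    have "(\<Sum>q\<in>?P. of_int (sign q) * (\<Prod>i<k. x i (f (q i))))
        = (\<Sum>q\<in>?P. of_int (sign (inv q)) * (\<Prod>i<k. x i (f (inv q i))))"
      by (rule sum_permutations_inverse)
    also have "\<dots> = (\<Sum>q\<in>?P. of_int (sign q) * (\<Prod>i<k. x (q i) (f i)))"
    proof (rule sum.cong[OF refl])
      fix q assume "q \<in> ?P"
      hence q: "q permutes {..<k}" by simp
      have "(\<Prod>i<k. x i (f (inv q i))) = (\<Prod>i<k. x (q i) (f (inv q (q i))))"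
        by (rule prod.permute[OF q, of "\<lambda>i. x i (f (inv q i))", unfolded o_def])
      thus "of_int (sign (inv q)) * (\<Prod>i<k. x i (f (inv q i))) = of_int (sign q) * (\<Prod>i<k. x (q i) (f i))"
        using permutes_imp_permutation[OF finite_lessThan q] permutes_inverses(2)[OF q]
        by (simp add: sign_inverse)
    qed
    finally show ?thesis by (simp add: X_def leibniz_det_def)
  qed
  have "fact k * L = (\<Sum>q\<in>?P. L)" by (simp add: card_permutations)
  also have "\<dots> = (\<Sum>q\<in>?P. \<Sum>f\<in>?F. of_int (sign q) * (\<Prod>i<k. x i (f (q i))) * Y f)"
    by (rule sum.cong[OF refl]) (use Lq in simp)
  also have "\<dots> = (\<Sum>f\<in>?F. (\<Sum>q\<in>?P. of_int (sign q) * (\<Prod>i<k. x i (f (q i)))) * Y f)"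
    by (simp add: sum_distrib_right sum.swap[of _ ?F])
  finally show ?thesis unfolding XX unfolding L_def X_def Y_def .
qed

text \<open>An exchange argument: chosen indices from \<open>k\<close> on are as many as the omitted
  indices below \<open>k\<close>, and the value \<open>g k\<close> separates the two groups of
  factors.\<close>

lemma prod_inj_le_prod_initial:
  fixes g :: "nat \<Rightarrow> real"
  assumes mono: "\<And>i j. i \<le> j \<Longrightarrow> j < n \<Longrightarrow> g j \<le> g i" and nn: "\<And>i. i < n \<Longrightarrow> 0 \<le> g i"
    and inj: "inj_on f {..<k}" and f: "\<And>i. i < k \<Longrightarrow> f i < n"
  shows "(\<Prod>i<k. g (f i)) \<le> (\<Prod>i<k. g i)"
proof -
  let ?S = "f ` {..<k}" and ?K = "{..<k}"
  have cS: "card ?S = k" using inj by (simp add: card_image)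
  have "card ?S \<le> card {..<n}" using f by (intro card_mono) auto
  hence kn: "k \<le> n" using cS by simp
  have Sn: "a < n" if "a \<in> ?S" for a using that f by auto
  have card_eq: "card (?S - ?K) = card (?K - ?S)"
    using cS card_Diff_subset_Int[of ?S ?K] card_Diff_subset_Int[of ?K ?S] by (simp add: Int_commute)
  have le: "(\<Prod>a\<in>?S - ?K. g a) \<le> (\<Prod>a\<in>?K - ?S. g a)"
  proof (cases "?S - ?K = {}")
    case True
    hence "?K - ?S = {}" using card_eq by (metis card.empty card_0_eq finite_Diff finite_lessThan)
    thus ?thesis using True by (simp only: prod.empty order_refl)
  next
    case False
    then obtain a where "a \<in> ?S" "k \<le> a" by force
    hence k: "k < n" using Sn by fastforce
    have "(\<Prod>a\<in>?S - ?K. g a) \<le> (\<Prod>a\<in>?S - ?K. g k)"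
    proof (rule prod_mono)
      fix a assume "a \<in> ?S - ?K"
      hence "k \<le> a" "a < n" using Sn[of a] by auto
      thus "0 \<le> g a \<and> g a \<le> g k" using mono[of k a] nn[of a] by simp
    qed
    also have "\<dots> = (\<Prod>a\<in>?K - ?S. g k)" by (simp only: prod_constant card_eq)
    also have "\<dots> \<le> (\<Prod>a\<in>?K - ?S. g a)"
    proof (rule prod_mono)
      fix a assume "a \<in> ?K - ?S"
      hence "a < k" by simp
      thus "0 \<le> g k \<and> g k \<le> g a" using k mono[of a k] nn[of k] by simp
    qed
    finally show ?thesis .
  qed
  have "(\<Prod>i<k. g (f i)) = (\<Prod>a\<in>?S. g a)" using inj by (simp add: prod.reindex)
  also have "\<dots> = (\<Prod>a\<in>?S \<inter> ?K. g a) * (\<Prod>a\<in>?S - ?K. g a)"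
    by (rule prod.Int_Diff) simp
  also have "\<dots> \<le> (\<Prod>a\<in>?S \<inter> ?K. g a) * (\<Prod>a\<in>?K - ?S. g a)"
    using le by (rule mult_left_mono) (use nn Sn in \<open>auto intro!: prod_nonneg\<close>)
  also have "\<dots> = (\<Prod>i<k. g i)"
    using prod.Int_Diff[of ?K g ?S] by (simp add: Int_commute)
  finally show ?thesis .
qed

text \<open>The squared volume of the parallelepiped spanned by the first \<open>k\<close>
  vectors.\<close>

definition gram_det :: "nat \<Rightarrow> (nat \<Rightarrow> real^'n) \<Rightarrow> real" where
  "gram_det k v = leibniz_det k (\<lambda>i j. v i \<bullet> v j)"

text \<open>
  The product of the \<open>k\<close> largest singular values is the largest factor by which \<open>A\<close> stretches
  \<open>k\<close>-dimensional volume; submultiplicativity is immediate from this.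
\<close>

lemma gram_det_matrix_le:
  fixes A :: "real^'n^'n"
  assumes k: "k \<le> CARD('n)"
  shows "gram_det k (\<lambda>i. A *v v i) \<le> (\<Prod>i<k. sigma A (Suc i))\<^sup>2 * gram_det k v"
proof -
  obtain b :: "nat \<Rightarrow> real^'n" where
    AA: "\<And>x y. (A *v x) \<bullet> (A *v y) = (\<Sum>i<CARD('n). (sigma A (Suc i))\<^sup>2 * (x \<bullet> b i) * (y \<bullet> b i))"
    and pars: "\<And>x y. x \<bullet> y = (\<Sum>i<CARD('n). (x \<bullet> b i) * (y \<bullet> b i))"
    and nn: "\<And>i. i < CARD('n) \<Longrightarrow> 0 \<le> sigma A (Suc i)"
    and mono: "\<And>i j. i \<le> j \<Longrightarrow> j < CARD('n) \<Longrightarrow> sigma A (Suc j) \<le> sigma A (Suc i)"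
    by (rule singular_value_basis[of A]) blast
  let ?F = "PiE {..<k} (\<lambda>_. {..<CARD('n)})"
  define D where "D f = leibniz_det k (\<lambda>i j. v j \<bullet> b (f i))" for f
  define s where "s i = sigma A (Suc i)" for i
  have "fact k * gram_det k (\<lambda>i. A *v v i)
      = fact k * leibniz_det k (\<lambda>i j. \<Sum>a<CARD('n). (s a * (v i \<bullet> b a)) * (s a * (v j \<bullet> b a)))"
    by (simp add: gram_det_def AA s_def power2_eq_square mult_ac)
  also have "\<dots> = (\<Sum>f\<in>?F. (\<Prod>i<k. s (f i))\<^sup>2 * (D f)\<^sup>2)"
    by (subst andreief_identity)
       (simp_all add: leibniz_det_scale_rows D_def power2_eq_square mult_ac)
  \<comment> \<open>The sums of squares are compared term by term. If \<open>f\<close> repeats an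
    index, \<open>D f\<close> has two equal rows and vanishes; otherwise the weight is a product of
    \<open>k\<close> singular values at distinct positions, hence at most the product of the first
    \<open>k\<close>.\<close>
  also have "\<dots> \<le> (\<Sum>f\<in>?F. (\<Prod>i<k. s i)\<^sup>2 * (D f)\<^sup>2)"
  proof (rule sum_mono)
    fix f assume f: "f \<in> ?F"
    show "(\<Prod>i<k. s (f i))\<^sup>2 * (D f)\<^sup>2 \<le> (\<Prod>i<k. s i)\<^sup>2 * (D f)\<^sup>2"
    proof (cases "inj_on f {..<k}")
      case True
      have "(\<Prod>i<k. s (f i)) \<le> (\<Prod>i<k. s i)"
        using f True by (intro prod_inj_le_prod_initial[where n = "CARD('n)"])
          (auto simp: s_def nn mono PiE_def Pi_def)
      moreover have "0 \<le> (\<Prod>i<k. s (f i))"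
        using f by (intro prod_nonneg) (auto simp: s_def nn PiE_def Pi_def)
      ultimately show ?thesis by (intro mult_right_mono power_mono) auto
    next
      case False
      then obtain i j where "i < k" "j < k" "i \<noteq> j" "f i = f j" by (auto simp: inj_on_def)
      hence "D f = 0" unfolding D_def by (intro leibniz_det_equal_rows[of i k j]) auto
      thus ?thesis by simp
    qed
  qed
  also have "\<dots> = (\<Prod>i<k. s i)\<^sup>2 * (\<Sum>f\<in>?F. D f * D f)"
    by (simp add: sum_distrib_left power2_eq_square)
  also have "(\<Sum>f\<in>?F. D f * D f) = fact k * gram_det k v"
  proof -
    have "gram_det k v = leibniz_det k (\<lambda>i j. \<Sum>a<CARD('n). (v i \<bullet> b a) * (v j \<bullet> b a))"
      by (simp add: gram_det_def pars[symmetric])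
    thus ?thesis by (simp add: andreief_identity D_def)
  qed
  finally show ?thesis by (simp add: s_def mult_ac)
qed

text \<open>The first \<open>k\<close> right singular vectors do it: they are orthonormal and their
  images are orthogonal, so both Gram matrices are diagonal.\<close>

lemma gram_det_matrix_attained:
  fixes A :: "real^'n^'n"
  assumes k: "k \<le> CARD('n)"
  obtains v :: "nat \<Rightarrow> real^'n"
  where "gram_det k v = 1" "gram_det k (\<lambda>i. A *v v i) = (\<Prod>i<k. sigma A (Suc i))\<^sup>2"
proof -
  obtain b :: "nat \<Rightarrow> real^'n" where
    on: "\<And>i j. i < CARD('n) \<Longrightarrow> j < CARD('n) \<Longrightarrow> b i \<bullet> b j = (if i = j then 1 else 0)"
    and AA: "\<And>x y. (A *v x) \<bullet> (A *v y) = (\<Sum>i<CARD('n). (sigma A (Suc i))\<^sup>2 * (x \<bullet> b i) * (y \<bullet> b i))"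
    by (rule singular_value_basis[of A]) blast
  have Ab: "(A *v b i) \<bullet> (A *v b j) = (if i = j then (sigma A (Suc i))\<^sup>2 else 0)"
    if "i < CARD('n)" "j < CARD('n)" for i j
  proof -
    have "(A *v b i) \<bullet> (A *v b j) = (\<Sum>l<CARD('n). if l = i then (if i = j then (sigma A (Suc i))\<^sup>2 else 0) else 0)"
      unfolding AA by (rule sum.cong) (use that in \<open>auto simp: on\<close>)
    thus ?thesis using that by simp
  qed
  have "gram_det k b = (\<Prod>i<k. b i \<bullet> b i)"
    unfolding gram_det_def using k by (intro leibniz_det_diagonal) (auto simp: on)
  also have "\<dots> = 1" using k by (intro prod.neutral) (auto simp: on)
  finally have "gram_det k b = 1" .
  moreover have "gram_det k (\<lambda>i. A *v b i) = (\<Prod>i<k. (A *v b i) \<bullet> (A *v b i))"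
    unfolding gram_det_def using k by (intro leibniz_det_diagonal) (auto simp: Ab)
  hence "gram_det k (\<lambda>i. A *v b i) = (\<Prod>i<k. (sigma A (Suc i))\<^sup>2)"
    using k by (simp add: Ab)
  ultimately show ?thesis using that by (simp add: prod_power_distrib)
qed

lemma sigma_nonneg: "i < CARD('n) \<Longrightarrow> 0 \<le> sigma (A :: real^'n^'n) (Suc i)"
  by (rule singular_value_basis[of A]) blast

lemma sigma_antimono: "i \<le> j \<Longrightarrow> j < CARD('n) \<Longrightarrow> sigma (A :: real^'n^'n) (Suc j) \<le> sigma A (Suc i)"
  by (rule singular_value_basis[of A]) blast

lemma prod_sigma_nonneg: "k \<le> CARD('n) \<Longrightarrow> 0 \<le> (\<Prod>i<k. sigma (A :: real^'n^'n) (Suc i))"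
  by (intro prod_nonneg) (auto simp: sigma_nonneg)

lemma prod_sigma_mult_le:
  fixes A B :: "real^'n^'n"
  assumes k: "k \<le> CARD('n)"
  shows "(\<Prod>i<k. sigma (A ** B) (Suc i)) \<le> (\<Prod>i<k. sigma A (Suc i)) * (\<Prod>i<k. sigma B (Suc i))"
proof -
  \<comment> \<open>A family that \<open>A ** B\<close> stretches as much as possible is stretched
    first by \<open>B\<close> and then by \<open>A\<close>, each within its own bound.\<close>
  obtain v :: "nat \<Rightarrow> real^'n" where v: "gram_det k v = 1"
    "gram_det k (\<lambda>i. (A ** B) *v v i) = (\<Prod>i<k. sigma (A ** B) (Suc i))\<^sup>2"
    by (rule gram_det_matrix_attained[OF k])
  have "(\<Prod>i<k. sigma (A ** B) (Suc i))\<^sup>2 = gram_det k (\<lambda>i. A *v (B *v v i))"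
    by (simp add: v(2)[symmetric] matrix_vector_mul_assoc)
  also have "\<dots> \<le> (\<Prod>i<k. sigma A (Suc i))\<^sup>2 * gram_det k (\<lambda>i. B *v v i)"
    by (rule gram_det_matrix_le[OF k])
  also have "\<dots> \<le> (\<Prod>i<k. sigma A (Suc i))\<^sup>2 * ((\<Prod>i<k. sigma B (Suc i))\<^sup>2 * gram_det k v)"
    by (intro mult_left_mono gram_det_matrix_le k) simp
  finally show ?thesis
    using power2_le_imp_le by (simp add: v(1) power_mult_distrib[symmetric] prod_sigma_nonneg k)
qed

section \<open>Perturbation and continuity of singular values\<close>

lemma norm_matrix_vector_le:
  fixes M :: "real^'n^'m"
  shows "norm (M *v x) \<le> norm M * norm x"
proof -
  have "norm (M *v x) = L2_set (\<lambda>i. norm ((M *v x) $ i)) UNIV" by (rule norm_vec_def)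
  also have "\<dots> \<le> L2_set (\<lambda>i. norm (M $ i) * norm x) UNIV"
  proof (rule L2_set_mono)
    fix i show "norm ((M *v x) $ i) \<le> norm (M $ i) * norm x"
      using Cauchy_Schwarz_ineq2[of "M $ i" x] by (simp add: matrix_vector_mul_component)
  qed simp
  also have "\<dots> = norm M * norm x" 
    unfolding norm_vec_def[of M] by (rule L2_set_left_distrib[symmetric]) simp
  finally show ?thesis .
qed

text \<open>Weyl's inequality, in the Frobenius norm, which dominates the operator norm. The n - 1 -
  i singular vectors of \<open>A\<close> after position i and the i vectors of \<open>B\<close>
  before it number at most n - 1, so some nonzero \<open>x\<close> is orthogonal to all of them. On
  this \<open>x\<close>, \<open>A\<close> stretches by at least its value at i and \<open>B\<close>
  by at most its own.\<close>

lemma sigma_le_sigma_add_norm: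
  fixes A B :: "real^'n^'n"
  assumes i: "i < CARD('n)"
  shows "sigma A (Suc i) \<le> sigma B (Suc i) + norm (A - B)"
proof -
  let ?n = "CARD('n)"
  obtain a :: "nat \<Rightarrow> real^'n" where
    A: "\<And>x y. (A *v x) \<bullet> (A *v y) = (\<Sum>i<?n. (sigma A (Suc i))\<^sup>2 * (x \<bullet> a i) * (y \<bullet> a i))"
    and pa: "\<And>x y. x \<bullet> y = (\<Sum>i<?n. (x \<bullet> a i) * (y \<bullet> a i))"
    by (rule singular_value_basis[of A]) blast
  obtain b :: "nat \<Rightarrow> real^'n" where
    B: "\<And>x y. (B *v x) \<bullet> (B *v y) = (\<Sum>i<?n. (sigma B (Suc i))\<^sup>2 * (x \<bullet> b i) * (y \<bullet> b i))"
    and pb: "\<And>x y. x \<bullet> y = (\<Sum>i<?n. (x \<bullet> b i) * (y \<bullet> b i))"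
    by (rule singular_value_basis[of B]) blast
  let ?S = "a ` {Suc i..<?n} \<union> b ` {..<i}"
  have "card ?S \<le> card (a ` {Suc i..<?n}) + card (b ` {..<i})" by (rule card_Un_le)
  also have "\<dots> \<le> card {Suc i..<?n} + card {..<i}"
    by (intro add_mono card_image_le) auto
  also have "\<dots> < ?n" using i by simp
  finally have "dim ?S < DIM(real^'n)" using dim_le_card'[of ?S] by simp
  then obtain x where x: "x \<noteq> 0" "\<And>y. y \<in> span ?S \<Longrightarrow> orthogonal x y"
    by (rule orthogonal_to_subspace_exists) blast
  have xa: "x \<bullet> a j = 0" if "i < j" "j < ?n" for j
    using x(2)[of "a j"] that by (simp add: span_base orthogonal_def)
  have xb: "x \<bullet> b j = 0" if "j < i" for j
    using x(2)[of "b j"] that by (simp add: span_base orthogonal_def)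
  have "(sigma A (Suc i) * norm x)\<^sup>2 = (\<Sum>j<?n. (sigma A (Suc i))\<^sup>2 * ((x \<bullet> a j) * (x \<bullet> a j)))"
    unfolding power_mult_distrib power2_norm_eq_inner pa[of x x] by (rule sum_distrib_left)
  also have "\<dots> \<le> (norm (A *v x))\<^sup>2"
    unfolding power2_norm_eq_inner A[of x x]
  proof (rule sum_mono)
    fix j assume j: "j \<in> {..<?n}"
    show "(sigma A (Suc i))\<^sup>2 * ((x \<bullet> a j) * (x \<bullet> a j)) \<le> (sigma A (Suc j))\<^sup>2 * (x \<bullet> a j) * (x \<bullet> a j)"
    proof (cases "j \<le> i")
      case True
      hence "(sigma A (Suc i))\<^sup>2 \<le> (sigma A (Suc j))\<^sup>2"
        by (intro power_mono sigma_antimono sigma_nonneg i)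
      thus ?thesis unfolding mult.assoc by (rule mult_right_mono) simp
    qed (use xa j in simp)
  qed
  finally have 1: "sigma A (Suc i) * norm x \<le> norm (A *v x)"
    by (rule power2_le_imp_le) simp
  have "(norm (B *v x))\<^sup>2 \<le> (\<Sum>j<?n. (sigma B (Suc i))\<^sup>2 * ((x \<bullet> b j) * (x \<bullet> b j)))"
    unfolding power2_norm_eq_inner B[of x x]
  proof (rule sum_mono)
    fix j assume j: "j \<in> {..<?n}"
    show "(sigma B (Suc j))\<^sup>2 * (x \<bullet> b j) * (x \<bullet> b j) \<le> (sigma B (Suc i))\<^sup>2 * ((x \<bullet> b j) * (x \<bullet> b j))"
    proof (cases "i \<le> j")
      case True
      hence "(sigma B (Suc j))\<^sup>2 \<le> (sigma B (Suc i))\<^sup>2"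
        using j by (intro power_mono sigma_antimono sigma_nonneg) auto
      thus ?thesis unfolding mult.assoc by (rule mult_right_mono) simp
    qed (use xb in simp)
  qed
  also have "\<dots> = (sigma B (Suc i) * norm x)\<^sup>2"
    unfolding power_mult_distrib power2_norm_eq_inner pb[of x x] by (rule sum_distrib_left[symmetric])
  finally have 2: "norm (B *v x) \<le> sigma B (Suc i) * norm x"
    by (rule power2_le_imp_le) (simp add: sigma_nonneg[OF i])
  have "norm (A *v x) \<le> norm (B *v x) + norm ((A - B) *v x)"
    using norm_triangle_ineq[of "B *v x" "(A - B) *v x"] by (simp add: matrix_vector_mult_diff_rdistrib)
  also have "norm ((A - B) *v x) \<le> norm (A - B) * norm x" by (rule norm_matrix_vector_le)
  finally have "sigma A (Suc i) * norm x \<le> (sigma B (Suc i) + norm (A - B)) * norm x"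
    using 1 2 by (simp add: distrib_right)
  thus ?thesis using x(1) by simp
qed

lemma continuous_on_sigma [continuous_intros]:
  fixes M :: "'a::topological_space \<Rightarrow> real^'n^'n"
  assumes M: "continuous_on S M" and i: "i < CARD('n)"
  shows "continuous_on S (\<lambda>u. sigma (M u) (Suc i))"
proof -
  have "continuous_on UNIV (\<lambda>A :: real^'n^'n. sigma A (Suc i))"
    unfolding continuous_on_iff
  proof (intro ballI allI impI)
    fix A :: "real^'n^'n" and e :: real assume "e > 0"
    moreover have "dist (sigma B (Suc i)) (sigma A (Suc i)) \<le> dist B A" for B
      using sigma_le_sigma_add_norm[OF i, of A B] sigma_le_sigma_add_norm[OF i, of B A]
      by (simp add: dist_norm norm_minus_commute abs_le_iff)
    ultimately show "\<exists>d>0. \<forall>B\<in>UNIV. dist B A < d \<longrightarrow> dist (sigma B (Suc i)) (sigma A (Suc i)) < e"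
      by (meson le_less_trans)
  qed
  from continuous_on_compose2[OF this M] show ?thesis by auto
qed

section \<open>The singular value function\<close>

lemma prod_sigma_ge_1:
  fixes A :: "real^'n^'n"
  assumes "\<And>i. i < k \<Longrightarrow> 1 \<le> sigma A (Suc i)"
  shows "1 \<le> (\<Prod>i<k. sigma A (Suc i))"
  using assms by (intro prod_ge_1) auto

lemma prod_sigma_decreasing:
  fixes A :: "real^'n^'n"
  assumes "k \<le> l" "l \<le> CARD('n)" "\<And>i. k \<le> i \<Longrightarrow> i < l \<Longrightarrow> sigma A (Suc i) \<le> 1"
  shows "(\<Prod>i<l. sigma A (Suc i)) \<le> (\<Prod>i<k. sigma A (Suc i))"
  using assms
proof (induction l rule: dec_induct)
  case (step m)
  have "(\<Prod>i<Suc m. sigma A (Suc i)) \<le> (\<Prod>i<m. sigma A (Suc i)) * 1"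
    unfolding prod.lessThan_Suc using step prod_sigma_nonneg[of m A]
    by (intro mult_left_mono) auto
  also have "\<dots> \<le> (\<Prod>i<k. sigma A (Suc i))" using step by simp
  finally show ?case .
qed simp

text \<open>\<open>k\<close> depends on \<open>d\<close> alone, so each case states its equation for
  all matrices at once; a single case split then serves \<open>A\<close>, \<open>B\<close> and
  \<open>A ** B\<close> together.\<close>

lemma singular_value_function_cases:
  assumes "0 \<le> d" "d \<le> real CARD('n)"
  obtains k where "k \<le> CARD('n)" "d = real k"
      "\<And>A :: real^'n^'n. singular_value_function d A = (\<Prod>i<k. sigma A (Suc i))"
  | k where "k < CARD('n)" "real k < d" "d < real k + 1"
      "\<And>A :: real^'n^'n. singular_value_function d A
         = (\<Prod>i<k. sigma A (Suc i)) * sigma A (Suc k) powr (d - real k)"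
proof -
  define k where "k = nat \<lfloor>d\<rfloor>"
  have k: "real k \<le> d" "d < real k + 1" using assms(1) unfolding k_def by linarith+
  have P: "(\<Prod>i=1..k. sigma A i) = (\<Prod>i<k. sigma A (Suc i))" for A :: "real^'n^'n"
    by (simp add: prod.atLeast1_atMost_eq)
  show ?thesis
  proof (cases "d = real k")
    case True
    hence "singular_value_function d A = (\<Prod>i<k. sigma A (Suc i))" for A :: "real^'n^'n"
      unfolding singular_value_function_def Let_def k_def[symmetric] P by simp
    thus ?thesis using that(1)[of k] True assms by simp
  next
    case False
    hence "singular_value_function d A = (\<Prod>i<k. sigma A (Suc i)) * sigma A (Suc k) powr (d - real k)"
      for A :: "real^'n^'n"
      unfolding singular_value_function_def Let_def k_def[symmetric] P Suc_eq_plus1 by simp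
    thus ?thesis using that(2)[of k] False assms k by simp
  qed
qed

text \<open>With \<open>p\<close> the product of the first k singular values and \<open>s\<close>
  the next one, this writes omega_(k+t) as the geometric mean of omega_k and omega_(k+1). It
  survives \<open>p = 0\<close> because \<open>0 powr x\<close> is 0 for every
  \<open>x\<close>.\<close>

lemma powr_interpolation:
  fixes p s t :: real
  assumes "0 \<le> p" "0 \<le> s"
  shows "p * s powr t = p powr (1 - t) * (p * s) powr t"
proof -
  have "p powr (1 - t) * (p * s) powr t = (p powr (1 - t) * p powr t) * s powr t"
    using assms by (simp add: powr_mult)
  also have "p powr (1 - t) * p powr t = p" using assms by (simp add: powr_add[symmetric])
  finally show ?thesis by simp
qed

context
  fixes d :: real
  assumes d: "0 \<le> d" "d \<le> real CARD('n::finite)"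
begin

lemma singular_value_function_nonneg: "0 \<le> singular_value_function d (A :: real^'n^'n)"
  by (rule singular_value_function_cases[OF d]) (simp_all add: prod_sigma_nonneg)

lemma singular_value_function_mult_le:
  fixes A B :: "real^'n^'n"
  shows "singular_value_function d (A ** B) \<le> singular_value_function d A * singular_value_function d B"
proof (rule singular_value_function_cases[OF d])
  fix k assume "k \<le> CARD('n)"
    "\<And>A :: real^'n^'n. singular_value_function d A = (\<Prod>i<k. sigma A (Suc i))"
  thus ?thesis by (simp add: prod_sigma_mult_le)
next
  fix k assume k: "k < CARD('n)" "real k < d" "d < real k + 1"
    and eq: "\<And>A :: real^'n^'n. singular_value_function d A
         = (\<Prod>i<k. sigma A (Suc i)) * sigma A (Suc k) powr (d - real k)"
  define P where "P l M = (\<Prod>i<l. sigma M (Suc i))" for l and M :: "real^'n^'n"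
  have P0: "0 \<le> P k M" "0 \<le> P (Suc k) M" for M
    unfolding P_def using k by (auto intro!: prod_sigma_nonneg simp del: prod.lessThan_Suc)
  have PS: "P (Suc k) M = P k M * sigma M (Suc k)" for M by (simp add: P_def)
  have eq': "singular_value_function d M = P k M powr (1 - (d - k)) * P (Suc k) M powr (d - k)" for M
    unfolding PS eq P_def[symmetric]
    using P0(1)[of M] sigma_nonneg[OF k(1), of M] by (rule powr_interpolation)
  have "singular_value_function d (A ** B)
      \<le> (P k A * P k B) powr (1 - (d - k)) * (P (Suc k) A * P (Suc k) B) powr (d - k)"
    unfolding eq' using k P0
    by (intro mult_mono powr_mono2) (auto simp: P_def intro!: prod_sigma_mult_le simp del: prod.lessThan_Suc)
  also have "\<dots> = singular_value_function d A * singular_value_function d B"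
    unfolding eq' using P0 by (simp add: powr_mult mult_ac)
  finally show ?thesis .
qed

lemma continuous_on_singular_value_function:
  fixes M :: "'a::topological_space \<Rightarrow> real^'n^'n"
  assumes M: "continuous_on S M"
  shows "continuous_on S (\<lambda>u. singular_value_function d (M u))"
proof (rule singular_value_function_cases[OF d])
  fix k assume "k \<le> CARD('n)"
    "\<And>A :: real^'n^'n. singular_value_function d A = (\<Prod>i<k. sigma A (Suc i))"
  thus ?thesis by (auto intro!: continuous_intros M)
next
  fix k assume k: "k < CARD('n)" "real k < d" "d < real k + 1"
    and eq: "\<And>A :: real^'n^'n. singular_value_function d A
         = (\<Prod>i<k. sigma A (Suc i)) * sigma A (Suc k) powr (d - real k)"
  \<comment> \<open>Where the singular value is 0, continuity of \<open>powr\<close> requires a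
    positive exponent; \<open>real k < d\<close> supplies it.\<close>
  thus ?thesis unfolding eq
    by (intro continuous_on_mult continuous_on_prod continuous_on_powr' continuous_on_sigma M
        continuous_on_const) (auto simp: sigma_nonneg)
qed

text \<open>A product below 1 must contain a factor below 1. Since the factors are sorted, all later
  ones are below 1 as well, so further factors or larger exponents cannot bring the product back to
  1.\<close>

lemma singular_value_function_less_1_mono:
  fixes A :: "real^'n^'n"
  assumes c: "0 \<le> c" "c \<le> d" and lt: "singular_value_function c A < 1"
  shows "singular_value_function d A < 1"
proof -
  define P where "P l = (\<Prod>i<l. sigma A (Suc i))" for l
  have c': "c \<le> real CARD('n)" using c d by simp
  have upper: "singular_value_function d A \<le> P k"
    if k: "real k \<le> d" and s: "\<And>j. k \<le> j \<Longrightarrow> j < CARD('n) \<Longrightarrow> sigma A (Suc j) \<le> 1" for k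
  proof (rule singular_value_function_cases[OF d])
    fix l assume "l \<le> CARD('n)" "d = real l"
      "\<And>A :: real^'n^'n. singular_value_function d A = (\<Prod>i<l. sigma A (Suc i))"
    thus ?thesis unfolding P_def using k s by (auto intro!: prod_sigma_decreasing)
  next
    fix l assume l: "l < CARD('n)" "real l < d" "d < real l + 1"
      and eq: "\<And>A :: real^'n^'n. singular_value_function d A
         = (\<Prod>i<l. sigma A (Suc i)) * sigma A (Suc l) powr (d - real l)"
    have kl: "k \<le> l" using k l by linarith
    have "singular_value_function d A \<le> P l * 1"
      unfolding eq P_def using l kl s[of l] sigma_nonneg[of l, where A = A]
      by (intro mult_left_mono powr_le1 prod_sigma_nonneg) auto
    also have "\<dots> \<le> P k" unfolding P_def using l kl s by (auto intro!: prod_sigma_decreasing)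
    finally show ?thesis .
  qed
  show ?thesis
  proof (rule singular_value_function_cases[OF c(1) c'])
    fix k assume k: "k \<le> CARD('n)" "c = real k"
      "\<And>A :: real^'n^'n. singular_value_function c A = (\<Prod>i<k. sigma A (Suc i))"
    then obtain i where i: "i < k" "sigma A (Suc i) < 1"
      using lt prod_sigma_ge_1[of k A] by (force simp: not_less)
    have "sigma A (Suc j) \<le> 1" if "k \<le> j" "j < CARD('n)" for j
      using sigma_antimono[of i j A] i that by simp
    hence "singular_value_function d A \<le> P k" using upper[of k] k c by simp
    thus ?thesis using lt k by (simp add: P_def)
  next
    fix k assume k: "k < CARD('n)" "real k < c" "c < real k + 1"
      and eq: "\<And>A :: real^'n^'n. singular_value_function c A
         = (\<Prod>i<k. sigma A (Suc i)) * sigma A (Suc k) powr (c - real k)"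
    have s1: "sigma A (Suc k) < 1"
    proof (rule ccontr)
      assume "\<not> sigma A (Suc k) < 1"
      hence "1 \<le> sigma A (Suc i)" if "i \<le> k" for i
        using sigma_antimono[OF that k(1), of A] by simp
      hence "1 * 1 \<le> P k * sigma A (Suc k) powr (c - real k)"
        unfolding P_def using k by (intro mult_mono prod_sigma_ge_1 ge_one_powr_ge_zero prod_sigma_nonneg) auto
      thus False using lt by (simp add: eq P_def)
    qed
    have s0: "0 \<le> sigma A (Suc k)" using k by (intro sigma_nonneg)
    have P0: "0 \<le> P k" unfolding P_def using k by (intro prod_sigma_nonneg) simp
    have s: "sigma A (Suc j) \<le> 1" if "k \<le> j" "j < CARD('n)" for j
      using sigma_antimono[OF that, of A] s1 by simp
    \<comment> \<open>The base is at most 1, so larger exponents give smaller values. If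
      \<open>d\<close> is at least \<open>Suc k\<close>, the comparison goes through
      \<open>P (Suc k)\<close>, where the exponent \<open>c - real k\<close> has grown to 1;
      otherwise \<open>c\<close> and \<open>d\<close> share the same \<open>k\<close> and only the
      exponents differ.\<close>
    have "singular_value_function d A \<le> P k * sigma A (Suc k) powr (c - real k)"
    proof (cases "real (Suc k) \<le> d")
      case True
      have "singular_value_function d A \<le> P (Suc k)" using upper[OF True] s by simp
      also have "\<dots> = P k * sigma A (Suc k) powr 1" using s0 by (simp add: P_def)
      also have "\<dots> \<le> P k * sigma A (Suc k) powr (c - real k)"
        using s0 s1 k P0 by (intro mult_left_mono powr_mono') auto
      finally show ?thesis .
    next
      case False
      show ?thesis
      proof (rule singular_value_function_cases[OF d])
        fix l assume l: "d = real l"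
        hence "Suc k \<le> l" using k c by linarith
        thus ?thesis using False l by simp
      next
        fix l assume l: "real l < d" "d < real l + 1" 
          and eql: "\<And>A :: real^'n^'n. singular_value_function d A
         = (\<Prod>i<l. sigma A (Suc i)) * sigma A (Suc l) powr (d - real l)"
        have "l = k" using False k c l by linarith
        thus ?thesis unfolding eql P_def[symmetric] using s0 s1 k c P0
          by (auto intro!: mult_left_mono powr_mono')
      qed
    qed
    thus ?thesis using lt by (simp add: eq P_def)
  qed
qed

end

section \<open>Uniform linearization and Gronwall's inequality\<close>

lemma jacobian_eqI:
  fixes f :: "real^'n \<Rightarrow> real^'m"
  assumes "(f has_derivative (\<lambda>h. M *v h)) (at x)"
  shows "jacobian f (at x) = M"
  using frechet_derivative_at[OF assms] 
  by (metis jacobian_def matrix_of_matrix_vector_mul)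

text \<open>Each row of \<open>M\<close>, scaled to length \<open>r\<close>, serves as test vector
  for its own norm, and the Frobenius norm is at most the sum of the row norms. One small sphere as
  hypothesis is what comparisons of local linear approximations can offer.\<close>

lemma norm_matrix_le:
  fixes M :: "real^'n^'m" and e r :: real
  assumes r: "0 < r" and M: "\<And>x. norm x = r \<Longrightarrow> norm (M *v x) \<le> e * norm x"
  shows "norm M \<le> CARD('m) * e"
proof -
  have e: "0 \<le> e"
  proof -
    have nr: "norm (r *\<^sub>R axis undefined (1::real) :: real^'n) = r" using r by simp
    have "0 \<le> e * r" using order_trans[OF norm_ge_zero M[OF nr]] nr by simp
    thus ?thesis using r by (simp add: zero_le_mult_iff)
  qed
  have "norm (M $ i) \<le> e" for i
  proof (cases "M $ i = 0")
    case False
    define x where "x = (r / norm (M $ i)) *\<^sub>R (M $ i)"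
    have nx: "norm x = r" using False r by (simp add: x_def)
    have "norm (M $ i) * r = \<bar>(M *v x) $ i\<bar>"
      using False r by (simp add: x_def matrix_vector_mult_scaleR matrix_vector_mul_component
          power2_norm_eq_inner[symmetric] power2_eq_square)
    also have "\<dots> \<le> norm (M *v x)" by (rule component_le_norm_cart)
    also have "\<dots> \<le> e * r" using M[OF nx] nx by simp
    finally show ?thesis using r by simp
  qed (use e in simp)
  hence "(\<Sum>i\<in>UNIV. norm (M $ i)) \<le> (\<Sum>i\<in>(UNIV::'m set). e)" by (intro sum_mono)
  moreover have "norm M \<le> (\<Sum>i\<in>UNIV. norm (M $ i))"
    unfolding norm_vec_def[of M] by (rule L2_set_le_sum) simp
  ultimately show ?thesis by simp
qed

text \<open>The matrix \<open>D\<close> may change with \<open>e\<close>. Two matrices approximating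
  the same increments are close on a common sphere, hence close in norm, so the matrices for e =
  1/(m+1) form a Cauchy sequence; its limit is the derivative.\<close>

lemma differentiable_if_approx_linear:
  fixes g :: "real^'n \<Rightarrow> real^'m"
  assumes H: "\<And>e. 0 < e \<Longrightarrow> \<exists>r>0. \<exists>D. \<forall>x. norm x \<le> r \<longrightarrow> norm (g (u + x) - g u - D *v x) \<le> e * norm x"
  shows "g differentiable at u"
proof -
  define c where "c = real CARD('m)"
  have c: "1 \<le> c" unfolding c_def using one_le_card_finite[where 'a='m] by linarith
  have "\<forall>m. \<exists>r D. 0 < r \<and> (\<forall>x. norm x \<le> r \<longrightarrow> norm (g (u + x) - g u - D *v x) \<le> inverse (real (Suc m)) * norm x)"
    using H by (metis inverse_positive_iff_positive of_nat_0_less_iff zero_less_Suc)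
  then obtain r D where r: "\<And>m. 0 < r m"
    and D: "\<And>m x. norm x \<le> r m \<Longrightarrow> norm (g (u + x) - g u - D m *v x) \<le> inverse (real (Suc m)) * norm x"
    by metis
  have DD: "norm (D m - D k) \<le> c * (inverse (real (Suc m)) + inverse (real (Suc k)))" for m k
    unfolding c_def
  proof (rule norm_matrix_le)
    show "0 < min (r m) (r k)" using r by simp
    fix x :: "real^'n" assume x: "norm x = min (r m) (r k)"
    have "(D m - D k) *v x = (g (u + x) - g u - D k *v x) - (g (u + x) - g u - D m *v x)"
      by (simp add: matrix_vector_mult_diff_rdistrib)
    also have "norm \<dots> \<le> norm (g (u + x) - g u - D k *v x) + norm (g (u + x) - g u - D m *v x)"
      by (rule norm_triangle_ineq4)
    also have "\<dots> \<le> inverse (real (Suc k)) * norm x + inverse (real (Suc m)) * norm x"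
      using x by (intro add_mono D) auto
    finally show "norm ((D m - D k) *v x) \<le> (inverse (real (Suc m)) + inverse (real (Suc k))) * norm x"
      by (simp only: distrib_right add.commute)
  qed
  have "Cauchy D"
  proof (rule metric_CauchyI)
    fix e :: real assume e: "0 < e"
    obtain N where N: "inverse (real (Suc N)) < e / (2 * c)"
      using reals_Archimedean[of "e / (2 * c)"] e c by auto
    have inv: "inverse (real (Suc m)) < e / (2 * c)" if "N \<le> m" for m
      using N that by (smt (verit) inverse_le_iff_le of_nat_0_less_iff of_nat_mono Suc_le_mono zero_less_Suc)
    have "dist (D m) (D k) < e" if "N \<le> m" "N \<le> k" for m k
    proof -
      have "dist (D m) (D k) \<le> c * (inverse (real (Suc m)) + inverse (real (Suc k)))"
        using DD by (simp add: dist_norm)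
      also have "\<dots> < c * (e / (2 * c) + e / (2 * c))"
        using inv[OF that(1)] inv[OF that(2)] c by (intro mult_strict_left_mono add_strict_mono) auto
      also have "\<dots> = e" using c by simp
      finally show ?thesis .
    qed
    thus "\<exists>M. \<forall>m\<ge>M. \<forall>n\<ge>M. dist (D m) (D n) < e" by blast
  qed
  then obtain E where E: "D \<longlonglongrightarrow> E" using Cauchy_convergent_iff convergent_def by blast
  \<comment> \<open>\<open>DD\<close> in the limit of large \<open>k\<close>.\<close>
  have DE: "norm (D m - E) \<le> c * inverse (real (Suc m))" for m
  proof (rule LIMSEQ_le)
    show "(\<lambda>k. norm (D m - D k)) \<longlonglongrightarrow> norm (D m - E)" by (intro tendsto_intros E)
    have "(\<lambda>k. c * (inverse (real (Suc m)) + inverse (real (Suc k)))) \<longlonglongrightarrow> c * (inverse (real (Suc m)) + 0)"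
      by (intro tendsto_intros LIMSEQ_inverse_real_of_nat)
    thus "(\<lambda>k. c * (inverse (real (Suc m)) + inverse (real (Suc k)))) \<longlonglongrightarrow> c * inverse (real (Suc m))" by simp
  qed (use DD in auto)
  have "(g has_derivative (\<lambda>h. E *v h)) (at u)"
    unfolding has_derivative_at_alt
  proof (intro conjI allI impI)
    show "bounded_linear (\<lambda>h. E *v h)" by (rule matrix_vector_mul_bounded_linear)
    fix e :: real assume e: "0 < e"
    obtain m where m: "inverse (real (Suc m)) < e / (2 * c)"
      using reals_Archimedean[of "e / (2 * c)"] e c by auto
    show "\<exists>d>0. \<forall>y. norm (y - u) < d \<longrightarrow> norm (g y - g u - E *v (y - u)) \<le> e * norm (y - u)"
    proof (intro exI[of _ "r m"] conjI allI impI r)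
      fix y assume "norm (y - u) < r m"
      hence 1: "norm (g y - g u - D m *v (y - u)) \<le> inverse (real (Suc m)) * norm (y - u)"
        using D[of "y - u" m] by simp
      have "norm ((D m - E) *v (y - u)) \<le> norm (D m - E) * norm (y - u)"
        by (rule norm_matrix_vector_le)
      also have "\<dots> \<le> (c * inverse (real (Suc m))) * norm (y - u)"
        by (intro mult_right_mono DE) simp
      finally have 2: "norm ((D m - E) *v (y - u)) \<le> (c * inverse (real (Suc m))) * norm (y - u)" .
      have eq: "g y - g u - E *v (y - u) = (g y - g u - D m *v (y - u)) + (D m - E) *v (y - u)"
        by (simp add: matrix_vector_mult_diff_rdistrib)
      have "norm (g y - g u - E *v (y - u)) \<le> inverse (real (Suc m)) * norm (y - u) + (c * inverse (real (Suc m))) * norm (y - u)"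
        unfolding eq by (rule norm_triangle_mono[OF 1 2])
      also have "\<dots> = ((1 + c) * inverse (real (Suc m))) * norm (y - u)" by (simp only: distrib_right mult_1)
      also have "\<dots> \<le> e * norm (y - u)"
      proof (rule mult_right_mono)
        have "(1 + c) * inverse (real (Suc m)) \<le> (2 * c) * (e / (2 * c))"
          using m c by (intro mult_mono) auto
        thus "(1 + c) * inverse (real (Suc m)) \<le> e" using c by simp
      qed simp
      finally show "norm (g y - g u - E *v (y - u)) \<le> e * norm (y - u)" .
    qed
  qed
  thus ?thesis by (rule differentiableI)
qed

text \<open>A criterion for C^1 that works from increments, without a formula for the derivative.
  \<open>D\<close> may depend on \<open>u\<close> and \<open>e\<close>, but \<open>r\<close> is
  common to all of \<open>K\<close>; this uniformity makes the Jacobian continuous.\<close>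

lemma C1_on_if_uniformly_approx_linear:
  fixes g :: "real^'n \<Rightarrow> real^'m"
  assumes H: "\<And>e. 0 < e \<Longrightarrow> \<exists>r>0. \<forall>u\<in>K. \<exists>D. \<forall>x. norm x \<le> r \<longrightarrow>
      norm (g (u + x) - g u - D *v x) \<le> e * norm x"
  shows "\<forall>u\<in>K. g differentiable at u" and "continuous_on K (\<lambda>u. jacobian g (at u))"
proof -
  show diff: "\<forall>u\<in>K. g differentiable at u"
  proof
    fix u assume "u \<in> K"
    thus "g differentiable at u" by (intro differentiable_if_approx_linear) (use H in metis)
  qed
  define J where "J u = jacobian g (at u)" for u
  define c where "c = real CARD('m)"
  have c: "1 \<le> c" unfolding c_def using one_le_card_finite[where 'a='m] by linarith
  \<comment> \<open>The Jacobian takes the place of \<open>D\<close> at the same radius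
    \<open>r\<close>. Differentiability only controls a ball whose radius depends on
    \<open>u\<close>, but two linear maps that are close on one small sphere are close
    everywhere.\<close>
  have unif: "\<exists>r>0. \<forall>u\<in>K. \<forall>x. norm x \<le> r \<longrightarrow> norm (g (u + x) - g u - J u *v x) \<le> e * norm x"
    if e: "0 < e" for e
  proof -
    define e' where "e' = e / (4 * c)"
    have e': "0 < e'" using e c by (simp add: e'_def)
    obtain r where r: "0 < r" and D: "\<And>u. u \<in> K \<Longrightarrow> \<exists>D. \<forall>x. norm x \<le> r \<longrightarrow>
      norm (g (u + x) - g u - D *v x) \<le> e' * norm x" using H[OF e'] by blast
    have "norm (g (u + x) - g u - J u *v x) \<le> e * norm x" if u: "u \<in> K" and x: "norm x \<le> r" for u x
    proof -
      obtain D where D: "\<And>x. norm x \<le> r \<Longrightarrow> norm (g (u + x) - g u - D *v x) \<le> e' * norm x"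
        using D[OF u] by blast
      have "(g has_derivative (\<lambda>h. J u *v h)) (at u)"
        using diff u by (simp add: J_def jacobian_works[symmetric])
      then obtain d where d: "0 < d" "\<And>y. norm (y - u) < d \<Longrightarrow> norm (g y - g u - J u *v (y - u)) \<le> e' * norm (y - u)"
        unfolding has_derivative_at_alt using e' by blast
      have "norm (D - J u) \<le> c * (2 * e')"
        unfolding c_def
      proof (rule norm_matrix_le)
        show "0 < min r (d / 2)" using r d by simp
        fix y :: "real^'n" assume y: "norm y = min r (d / 2)"
        have "(D - J u) *v y = (g (u + y) - g u - J u *v y) - (g (u + y) - g u - D *v y)"
          by (simp add: matrix_vector_mult_diff_rdistrib)
        also have "norm \<dots> \<le> norm (g (u + y) - g u - J u *v y) + norm (g (u + y) - g u - D *v y)"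
          by (rule norm_triangle_ineq4)
        also have "\<dots> \<le> e' * norm y + e' * norm y"
          using d(2)[of "u + y"] D[of y] y d(1) by (intro add_mono) auto
        finally show "norm ((D - J u) *v y) \<le> (2 * e') * norm y" by simp
      qed
      hence le: "norm ((D - J u) *v x) \<le> (c * (2 * e')) * norm x"
        using norm_matrix_vector_le[of "D - J u" x] by (meson mult_right_mono norm_ge_zero order_trans)
      have eq: "g (u + x) - g u - J u *v x = (g (u + x) - g u - D *v x) + (D - J u) *v x"
        by (simp add: matrix_vector_mult_diff_rdistrib)
      have "norm (g (u + x) - g u - J u *v x) \<le> e' * norm x + (c * (2 * e')) * norm x"
        unfolding eq by (rule norm_triangle_mono[OF D[OF x] le])
      also have "\<dots> = (e' + c * (2 * e')) * norm x" by (simp only: distrib_right)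
      also have "\<dots> \<le> e * norm x"
      proof (rule mult_right_mono)
        have "e' * 1 \<le> e' * c" using c e' by (intro mult_left_mono) auto
        hence "e' + c * (2 * e') \<le> (4 * c) * e'" using e' c by (simp add: mult.commute)
        also have "\<dots> = e" using c by (simp add: e'_def)
        finally show "e' + c * (2 * e') \<le> e" .
      qed simp
      finally show ?thesis .
    qed
    thus ?thesis using r by blast
  qed
  show "continuous_on K (\<lambda>u. jacobian g (at u))"
    unfolding continuous_on_iff J_def[symmetric]
  proof (intro ballI allI impI)
    fix u e assume u: "u \<in> K" and e: "(0::real) < e"
    \<comment> \<open>For \<open>x\<close> of length \<open>h\<close>, the point
      \<open>v + x\<close> is reached from \<open>u\<close> directly or through \<open>v\<close>.
      The three increments err by \<open>2 * h\<close>, \<open>h\<close> and \<open>h\<close> times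
      \<open>e'\<close>, so the Jacobians differ by at most \<open>c * (4 * e')\<close>, which is
      half of \<open>e\<close>.\<close>
    define e' where "e' = e / (8 * c)"
    have e': "0 < e'" using e c by (simp add: e'_def)
    obtain r where r: "0 < r" and R: "\<And>u x. u \<in> K \<Longrightarrow> norm x \<le> r \<Longrightarrow>
        norm (g (u + x) - g u - J u *v x) \<le> e' * norm x"
      using unif[OF e'] by blast
    show "\<exists>d>0. \<forall>v\<in>K. dist v u < d \<longrightarrow> dist (J v) (J u) < e"
    proof (intro exI[of _ "r / 2"] conjI ballI impI)
      show "0 < r / 2" using r by simp
      fix v assume v: "v \<in> K" "dist v u < r / 2"
      define h where "h = norm (v - u)"
      have h: "h < r / 2" using v by (simp add: h_def dist_norm)
      show "dist (J v) (J u) < e"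
      proof (cases "v = u")
        case False
        hence h0: "0 < h" by (simp add: h_def)
        have "norm (J v - J u) \<le> c * (4 * e')"
          unfolding c_def
        proof (rule norm_matrix_le[OF h0])
          fix x :: "real^'n" assume x: "norm x = h"
          have n: "norm (v - u + x) \<le> 2 * h" using x norm_triangle_ineq[of "v - u" x] by (simp add: h_def)
          have 1: "norm (g (v + x) - g v - J v *v x) \<le> e' * h"
            using R[of v x] v x h h0 by simp
          have "norm (g (u + (v - u + x)) - g u - J u *v (v - u + x)) \<le> e' * norm (v - u + x)"
            using n h by (intro R u) simp
          also have "\<dots> \<le> e' * (2 * h)" using n e' by (intro mult_left_mono) auto
          finally have 2: "norm (g (v + x) - g u - J u *v (v - u + x)) \<le> e' * (2 * h)" by simp
          have 3: "norm (g v - g u - J u *v (v - u)) \<le> e' * h"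
          proof -
            have "norm (v - u) \<le> r" using h r unfolding h_def by linarith
            from R[OF u this] show ?thesis by (simp add: h_def)
          qed
          have "(J v - J u) *v x = (g (v + x) - g u - J u *v (v - u + x))
              - (g (v + x) - g v - J v *v x) - (g v - g u - J u *v (v - u))"
            by (simp add: matrix_vector_mult_diff_rdistrib matrix_vector_right_distrib)
          hence "norm ((J v - J u) *v x) \<le> e' * (2 * h) + e' * h + e' * h"
            using 1 2 3 by (smt (verit) norm_triangle_ineq4)
          thus "norm ((J v - J u) *v x) \<le> (4 * e') * norm x" using x by simp
        qed
        also have "\<dots> < e" using c e by (simp add: e'_def)
        finally show ?thesis by (simp add: dist_norm)
      qed (use e in simp)
    qed
  qed
qed

text \<open>The squared norm is differentiable even where \<open>z\<close> vanishes. The cross term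
  \<open>2 * norm (z t) * c\<close> is at most the sum of the two squares; this accounts for the
  rate \<open>2 * L + 1\<close> and for \<open>c\<^sup>2\<close>. The weighted function
  \<open>g\<close> is then decreasing.\<close>

lemma gronwall_norm_square:
  fixes z :: "real \<Rightarrow> 'a::real_inner"
  assumes T: "0 \<le> T" and L: "0 \<le> L"
    and cont: "continuous_on {0..T} z"
    and z': "\<And>t. 0 < t \<Longrightarrow> t < T \<Longrightarrow> (z has_vector_derivative z' t) (at t)"
    and le: "\<And>t. 0 < t \<Longrightarrow> t < T \<Longrightarrow> norm (z' t) \<le> L * norm (z t) + c"
  shows "(norm (z T))\<^sup>2 \<le> ((norm (z 0))\<^sup>2 + c\<^sup>2 * T) * exp ((2 * L + 1) * T)"
proof -
  define a where "a = 2 * L + 1"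
  define g where "g t = (z t \<bullet> z t) * exp (- a * t) - c\<^sup>2 * t" for t
  have "g T \<le> g 0"
  proof (rule DERIV_nonpos_imp_decreasing_open[OF T])
    show "continuous_on {0..T} g" unfolding g_def by (intro continuous_intros cont)
    fix t assume t: "0 < t" "t < T"
    define y where "y = (2 * (z t \<bullet> z' t) - a * (z t \<bullet> z t)) * exp (- a * t) - c\<^sup>2"
    have "((\<lambda>t. z t \<bullet> z t) has_real_derivative 2 * (z t \<bullet> z' t)) (at t)"
      using bounded_bilinear.has_vector_derivative[OF bounded_bilinear_inner z'[OF t] z'[OF t]]
      by (simp add: has_real_derivative_iff_has_vector_derivative inner_commute)
    hence "(g has_real_derivative y) (at t)"
      unfolding g_def y_def by (auto intro!: derivative_eq_intros simp: algebra_simps)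
    moreover have "y \<le> 0"
    proof -
      have "z t \<bullet> z' t \<le> norm (z t) * norm (z' t)" by (rule norm_cauchy_schwarz)
      also have "\<dots> \<le> norm (z t) * (L * norm (z t) + c)" by (intro mult_left_mono le t) simp
      finally have "2 * (z t \<bullet> z' t) - a * (z t \<bullet> z t) \<le> 2 * (norm (z t) * c) - (norm (z t))\<^sup>2"
        by (simp add: a_def power2_norm_eq_inner[symmetric] power2_eq_square algebra_simps)
      also have "\<dots> \<le> c\<^sup>2"
        using zero_le_power2[of "norm (z t) - c"] by (simp add: power2_eq_square algebra_simps)
      finally have "(2 * (z t \<bullet> z' t) - a * (z t \<bullet> z t)) * exp (- a * t) \<le> c\<^sup>2 * exp (- a * t)"
        by (intro mult_right_mono) auto
      also have "\<dots> \<le> c\<^sup>2 * 1"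
      proof (rule mult_left_mono)
        have "0 \<le> a * t" using t L by (simp add: a_def)
        thus "exp (- a * t) \<le> 1" by simp
      qed simp
      finally show ?thesis by (simp add: y_def)
    qed
    ultimately show "\<exists>y. (g has_real_derivative y) (at t) \<and> y \<le> 0" by blast
  qed
  hence "(norm (z T))\<^sup>2 * exp (- a * T) \<le> (norm (z 0))\<^sup>2 + c\<^sup>2 * T"
    by (simp add: g_def power2_norm_eq_inner)
  hence "(norm (z T))\<^sup>2 * exp (- a * T) * exp (a * T) \<le> ((norm (z 0))\<^sup>2 + c\<^sup>2 * T) * exp (a * T)"
    by (rule mult_right_mono) simp
  moreover have "(norm (z T))\<^sup>2 = (norm (z T))\<^sup>2 * exp (- a * T) * exp (a * T)"
    by (simp add: mult.assoc exp_add[symmetric])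
  ultimately show ?thesis unfolding a_def by linarith
qed

text \<open>On a compact neighbourhood \<open>K'\<close> of \<open>K\<close> inside \<open>U\<close>
  the Jacobian is uniformly continuous. The mean value inequality for \<open>f\<close> minus its
  linear part at \<open>x\<close>, on a ball around \<open>x\<close>, then gives a radius
  independent of \<open>x\<close>.\<close>

lemma uniform_linearization:
  fixes f :: "real^'n \<Rightarrow> real^'n"
  assumes U: "open U" and K: "compact K" "K \<subseteq> U"
    and f: "continuously_differentiable_on U f" and e: "0 < e"
  obtains r where "0 < r" "\<And>x y. x \<in> K \<Longrightarrow> norm (y - x) \<le> r \<Longrightarrow>
    y \<in> U \<and> norm (f y - f x - jacobian f (at x) *v (y - x)) \<le> e * norm (y - x)"
proof -
  define J where "J u = jacobian f (at u)" for u
  obtain d where d: "0 < d" "(\<Union>x\<in>K. cball x d) \<subseteq> U"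
    using compact_subset_open_imp_cball_epsilon_subset[OF K(1) U K(2)] by blast
  define K' where "K' = (\<Union>x\<in>K. cball x d)"
  have "K' = {x + y |x y. x \<in> K \<and> y \<in> cball 0 d}"
  proof (intro equalityI subsetI)
    fix w assume "w \<in> K'"
    then obtain x where "x \<in> K" "dist x w \<le> d" by (auto simp: K'_def)
    hence "w = x + (w - x)" "w - x \<in> cball 0 d" by (auto simp: dist_norm norm_minus_commute)
    thus "w \<in> {x + y |x y. x \<in> K \<and> y \<in> cball 0 d}" using \<open>x \<in> K\<close> by blast
  next
    fix w assume "w \<in> {x + y |x y. x \<in> K \<and> y \<in> cball 0 d}"
    then obtain x y where "x \<in> K" "norm y \<le> d" "w = x + y" by auto
    hence "x \<in> K" "w \<in> cball x d" by (auto simp: dist_norm)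
    thus "w \<in> K'" unfolding K'_def by blast
  qed
  hence cK': "compact K'" using compact_sums[OF K(1) compact_cball[of 0 d]] by simp
  have "continuous_on K' J"
    using f d(2) unfolding continuously_differentiable_on_def J_def K'_def
    by (blast intro: continuous_on_subset)
  from compact_uniformly_continuous[OF this cK']
  obtain s where s: "0 < s" "\<And>x y. x \<in> K' \<Longrightarrow> y \<in> K' \<Longrightarrow> dist y x < s \<Longrightarrow> dist (J y) (J x) < e"
    unfolding uniformly_continuous_on_def using e by metis
  define r where "r = min d (s / 2)"
  have r: "0 < r" "r \<le> d" "r < s" using d s by (auto simp: r_def)
  show ?thesis
  proof (rule that[OF r(1)])
    fix x y assume x: "x \<in> K" and y: "norm (y - x) \<le> r"
    have sub: "w \<in> K' \<and> w \<in> U \<and> norm (J w - J x) \<le> e" if "w \<in> cball x r" for w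
    proof -
      have "w \<in> K'" using that r x by (force simp: K'_def)
      moreover have "x \<in> K'" using x d by (force simp: K'_def)
      moreover have "dist w x < s" using that r by (simp add: dist_commute)
      moreover have "w \<in> U" using \<open>w \<in> K'\<close> d(2) unfolding K'_def by blast
      ultimately show ?thesis using s(2)[of x w] by (simp add: dist_norm)
    qed
    define g where "g w = f w - J x *v w" for w
    have "norm (g y - g x) \<le> e * norm (y - x)"
    proof (rule differentiable_bound[of "cball x r" g "\<lambda>w h. (J w - J x) *v h"])
      fix w assume w: "w \<in> cball x r"
      have "(f has_derivative (\<lambda>h. J w *v h)) (at w)"
        using sub[OF w] f by (simp add: continuously_differentiable_on_def J_def jacobian_works[symmetric])
      hence "(g has_derivative (\<lambda>h. J w *v h - J x *v h)) (at w)"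
        unfolding g_def
        by (intro has_derivative_diff bounded_linear_imp_has_derivative matrix_vector_mul_bounded_linear)
      thus "(g has_derivative (\<lambda>h. (J w - J x) *v h)) (at w within cball x r)"
        by (simp add: matrix_vector_mult_diff_rdistrib has_derivative_at_withinI)
      show "onorm ((*v) (J w - J x)) \<le> e"
      proof (rule onorm_le)
        fix h
        have "norm ((J w - J x) *v h) \<le> norm (J w - J x) * norm h" by (rule norm_matrix_vector_le)
        also have "\<dots> \<le> e * norm h" using sub[OF w] by (intro mult_right_mono) auto
        finally show "norm ((J w - J x) *v h) \<le> e * norm h" .
      qed
    qed (use y r in \<open>auto simp: dist_norm norm_minus_commute\<close>)
    moreover have "g y - g x = f y - f x - J x *v (y - x)"
      by (simp add: g_def matrix_vector_mult_diff_distrib)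
    moreover have "y \<in> U" using sub[of y] y by (simp add: dist_norm norm_minus_commute)
    ultimately show "y \<in> U \<and> norm (f y - f x - jacobian f (at x) *v (y - x)) \<le> e * norm (y - x)"
      by (simp add: J_def)
  qed
qed

section \<open>Differentiability of the flow\<close>

context
  fixes U K :: "(real^'n) set" and f :: "real^'n \<Rightarrow> real^'n" and \<phi> :: "real \<Rightarrow> real^'n \<Rightarrow> real^'n"
  assumes U: "open U" and K: "compact K" "K \<subseteq> U"
    and f: "continuously_differentiable_on U f"
    and sol: "\<And>u. u \<in> U \<Longrightarrow> forward_solution U f u (\<lambda>t. \<phi> t u)"
    and inv: "\<And>t u. 0 \<le> t \<Longrightarrow> u \<in> K \<Longrightarrow> \<phi> t u \<in> K"
begin

lemma flow_0: "u \<in> U \<Longrightarrow> \<phi> 0 u = u"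
  using sol by (simp add: forward_solution_def)

lemma flow_deriv:
  assumes "u \<in> U" "0 < t"
  shows "((\<lambda>t. \<phi> t u) has_vector_derivative f (\<phi> t u)) (at t)"
proof -
  have "((\<lambda>t. \<phi> t u) has_vector_derivative f (\<phi> t u)) (at t within {0..})"
    using sol[OF assms(1)] assms(2) by (simp add: forward_solution_def)
  hence "((\<lambda>t. \<phi> t u) has_vector_derivative f (\<phi> t u)) (at t within {0<..})"
    by (rule has_vector_derivative_within_subset) auto
  thus ?thesis using assms(2) by (simp add: at_within_open[of t "{0<..}"])
qed

lemma flow_continuous: "u \<in> U \<Longrightarrow> continuous_on {0..T} (\<lambda>t. \<phi> t u)"
  unfolding continuous_on_eq_continuous_within
  using sol by (fastforce simp: forward_solution_def intro: continuous_within_subset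
      has_vector_derivative_continuous)

lemma jacobian_bounded_on_compact:
  obtains B where "0 \<le> B" "\<And>u. u \<in> K \<Longrightarrow> norm (jacobian f (at u)) \<le> B"
proof -
  have "continuous_on K (\<lambda>u. jacobian f (at u))"
    using f K by (auto simp: continuously_differentiable_on_def intro: continuous_on_subset)
  hence "bounded ((\<lambda>u. jacobian f (at u)) ` K)"
    using K(1) by (intro compact_imp_bounded compact_continuous_image)
  then obtain B where "0 < B" "\<forall>y\<in>(\<lambda>u. jacobian f (at u)) ` K. norm y \<le> B"
    unfolding bounded_pos by blast
  thus ?thesis by (intro that[of B]) auto
qed

text \<open>The Lipschitz bound for \<open>f\<close> holds only near \<open>K\<close>. The reference
  orbit stays in \<open>K\<close>, and a first exit time argument keeps the neighbouring orbit
  within reach of the bound up to time \<open>T\<close>.\<close>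

lemma flow_lipschitz_near:
  assumes T: "0 \<le> T"
  obtains M r where "1 \<le> M" "0 < r"
    "\<And>u v t. u \<in> K \<Longrightarrow> norm (v - u) \<le> r \<Longrightarrow> 0 \<le> t \<Longrightarrow> t \<le> T \<Longrightarrow>
      v \<in> U \<and> norm (\<phi> t v - \<phi> t u) \<le> M * norm (v - u)"
proof -
  obtain B where B: "0 \<le> B" "\<And>u. u \<in> K \<Longrightarrow> norm (jacobian f (at u)) \<le> B"
    using jacobian_bounded_on_compact by blast
  obtain r where r: "0 < r" and R: "\<And>x y. x \<in> K \<Longrightarrow> norm (y - x) \<le> r \<Longrightarrow>
    y \<in> U \<and> norm (f y - f x - jacobian f (at x) *v (y - x)) \<le> 1 * norm (y - x)"
    using uniform_linearization[OF U K f zero_less_one] by metis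
  define L where "L = B + 1"
  have L0: "0 \<le> L" using B by (simp add: L_def)
  have L: "norm (f y - f x) \<le> L * norm (y - x)" if "x \<in> K" "norm (y - x) \<le> r" for x y
  proof -
    have "norm (jacobian f (at x) *v (y - x)) \<le> norm (jacobian f (at x)) * norm (y - x)"
      by (rule norm_matrix_vector_le)
    also have "\<dots> \<le> B * norm (y - x)" using B that by (intro mult_right_mono) auto
    finally have "norm (f y - f x - jacobian f (at x) *v (y - x) + jacobian f (at x) *v (y - x))
        \<le> 1 * norm (y - x) + B * norm (y - x)"
      using R[OF that] by (intro norm_triangle_mono) auto
    thus ?thesis by (simp add: L_def distrib_right)
  qed
  define a where "a = 2 * L + 1"
  have a: "0 \<le> a" using L0 by (simp add: a_def)
  \<comment> \<open>Half the rate, since Gronwall's inequality bounds the square of the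
    norm.\<close>
  define M where "M = exp (a * T / 2)"
  have M: "1 \<le> M" using a T by (simp add: M_def)
  have M2: "M\<^sup>2 = exp (a * T)" by (simp add: M_def power2_eq_square exp_add[symmetric])
  have le: "norm (\<phi> t v - \<phi> t u) \<le> M * norm (v - u)"
    if u: "u \<in> K" and v: "v \<in> U" and t: "0 \<le> t" "t \<le> T"
      and near: "\<And>s. 0 < s \<Longrightarrow> s < t \<Longrightarrow> norm (\<phi> s v - \<phi> s u) \<le> r" for u v t
  proof (rule power2_le_imp_le)
    have uU: "u \<in> U" using u K by blast
    have "(norm (\<phi> t v - \<phi> t u))\<^sup>2
        \<le> ((norm (\<phi> 0 v - \<phi> 0 u))\<^sup>2 + 0\<^sup>2 * t) * exp ((2 * L + 1) * t)"
    proof (rule gronwall_norm_square[OF t(1) L0])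
      show "continuous_on {0..t} (\<lambda>s. \<phi> s v - \<phi> s u)"
        by (intro continuous_on_diff flow_continuous uU v)
      fix s assume s: "0 < s" "s < t"
      show "((\<lambda>s. \<phi> s v - \<phi> s u) has_vector_derivative f (\<phi> s v) - f (\<phi> s u)) (at s)"
        by (intro has_vector_derivative_diff flow_deriv uU v s)
      show "norm (f (\<phi> s v) - f (\<phi> s u)) \<le> L * norm (\<phi> s v - \<phi> s u) + 0"
        using L[OF inv[of s u] near[OF s]] u s by simp
    qed
    also have "\<dots> = (norm (v - u))\<^sup>2 * exp (a * t)" by (simp add: flow_0 uU v a_def)
    also have "\<dots> \<le> (norm (v - u))\<^sup>2 * M\<^sup>2"
      unfolding M2 using t a by (intro mult_left_mono) (auto intro: mult_left_mono)
    finally show "(norm (\<phi> t v - \<phi> t u))\<^sup>2 \<le> (M * norm (v - u))\<^sup>2"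
      by (simp add: power_mult_distrib mult.commute)
  qed (use M in simp)
  \<comment> \<open>Initial distances up to \<open>\<rho>\<close> grow to at most
    \<open>r / 2\<close>, strictly below the distance \<open>r\<close> at which control of
    \<open>f\<close> is lost.\<close>
  define \<rho> where "\<rho> = r / (2 * M)"
  have \<rho>: "0 < \<rho>" using r M by (simp add: \<rho>_def)
  have \<rho>r: "\<rho> \<le> r"
  proof -
    have "r * 1 \<le> r * (2 * M)" using r M by (intro mult_left_mono) auto
    thus ?thesis using M by (simp add: \<rho>_def divide_le_eq)
  qed
  show ?thesis
  proof (rule that[OF M \<rho>])
    fix u v t assume u: "u \<in> K" and v: "norm (v - u) \<le> \<rho>" and t: "0 \<le> t" "t \<le> T"
    have uU: "u \<in> U" using u K by blast
    have vU: "v \<in> U" using R[OF u, of v] v \<rho>r by simp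
    have Mv: "M * norm (v - u) < r"
    proof -
      have "M * norm (v - u) \<le> M * \<rho>" using v M by (intro mult_left_mono) auto
      also have "\<dots> = r / 2" using M by (simp add: \<rho>_def)
      finally show ?thesis using r by simp
    qed
    have near: "norm (\<phi> s v - \<phi> s u) < r" if s: "0 \<le> s" "s \<le> T" for s
    proof (rule ccontr)
      assume "\<not> norm (\<phi> s v - \<phi> s u) < r"
      \<comment> \<open>Before the first time \<open>\<tau>\<close> in \<open>S\<close> the orbits
        are closer than \<open>r\<close>, so \<open>le\<close> applies up to \<open>\<tau>\<close>
        and gives a distance below \<open>r\<close> there: a contradiction.\<close>
      define S where "S = {s \<in> {0..T}. r \<le> norm (\<phi> s v - \<phi> s u)}"
      have "s \<in> S" using s \<open>\<not> norm (\<phi> s v - \<phi> s u) < r\<close> by (simp add: S_def)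
      moreover have "compact S"
      proof -
        have "closed ({0..T} \<inter> (\<lambda>s. norm (\<phi> s v - \<phi> s u)) -` {r..})"
          by (intro continuous_closed_preimage continuous_intros flow_continuous uU vU)
        also have "{0..T} \<inter> (\<lambda>s. norm (\<phi> s v - \<phi> s u)) -` {r..} = S" by (auto simp: S_def)
        finally have "closed S" .
        moreover have "bounded S" by (rule bounded_subset[of "{0..T}"]) (auto simp: S_def)
        ultimately show ?thesis by (simp add: compact_eq_bounded_closed)
      qed
      ultimately obtain \<tau> where \<tau>: "\<tau> \<in> S" "\<And>s. s \<in> S \<Longrightarrow> \<tau> \<le> s"
        using compact_attains_inf[of S] by blast
      have "norm (\<phi> \<tau> v - \<phi> \<tau> u) \<le> M * norm (v - u)"
      proof (rule le[OF u vU])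
        fix s assume s: "0 < s" "s < \<tau>"
        hence "s \<notin> S" using \<tau>(2)[of s] by linarith
        thus "norm (\<phi> s v - \<phi> s u) \<le> r" using s \<tau>(1) by (auto simp: S_def)
      qed (use \<tau> in \<open>auto simp: S_def\<close>)
      thus False using Mv \<tau>(1) by (simp add: S_def)
    qed
    have "norm (\<phi> t v - \<phi> t u) \<le> M * norm (v - u)"
      by (rule le[OF u vU t]) (use near t in \<open>simp add: less_imp_le\<close>)
    thus "v \<in> U \<and> norm (\<phi> t v - \<phi> t u) \<le> M * norm (v - u)" using vU by simp
  qed
qed

text \<open>
  The variational equation need not be solved: by Gronwall's inequality the increment of the flow
  is, to first order and uniformly on \<open>K\<close>, the linear combination of increments of fixed small size
  along the coordinate axes.
\<close>

lemma flow_uniformly_approx_linear: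
  assumes T: "0 \<le> T" and e: "0 < e"
  shows "\<exists>r>0. \<forall>u\<in>K. \<exists>D. \<forall>x. norm x \<le> r \<longrightarrow> norm (\<phi> T (u + x) - \<phi> T u - D *v x) \<le> e * norm x"
proof -
  define n where "n = real CARD('n)"
  have n: "1 \<le> n" unfolding n_def using one_le_card_finite[where 'a='n] by linarith
  obtain L where L: "0 \<le> L" "\<And>u. u \<in> K \<Longrightarrow> norm (jacobian f (at u)) \<le> L"
    using jacobian_bounded_on_compact by blast
  obtain M r1 where M: "1 \<le> M" and r1: "0 < r1" and lip:
    "\<And>u v t. u \<in> K \<Longrightarrow> norm (v - u) \<le> r1 \<Longrightarrow> 0 \<le> t \<Longrightarrow> t \<le> T \<Longrightarrow>
      v \<in> U \<and> norm (\<phi> t v - \<phi> t u) \<le> M * norm (v - u)"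
    using flow_lipschitz_near[OF T] by metis
  \<comment> \<open>\<open>T + 1\<close> instead of \<open>T\<close> makes \<open>G\<close> at least
    1; then \<open>G\<close> may be replaced by its square, and a square root is taken without loss
    of form.\<close>
  define G where "G = (T + 1) * exp ((2 * L + 1) * T)"
  have G: "1 \<le> G"
  proof -
    have "1 * 1 \<le> G" unfolding G_def using T L by (intro mult_mono) auto
    thus ?thesis by simp
  qed
  \<comment> \<open>Chosen so that the final bound \<open>c * G\<close>, with
    \<open>c = \<eta> * M * (1 + n) * norm x\<close>, is exactly \<open>e * norm x\<close>.\<close>
  define \<eta> where "\<eta> = e / (M * (1 + n) * G)"
  have \<eta>: "0 < \<eta>" using e M n G by (simp add: \<eta>_def)
  obtain r2 where r2: "0 < r2" and lin: "\<And>x y. x \<in> K \<Longrightarrow> norm (y - x) \<le> r2 \<Longrightarrow>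
    y \<in> U \<and> norm (f y - f x - jacobian f (at x) *v (y - x)) \<le> \<eta> * norm (y - x)"
    using uniform_linearization[OF U K f \<eta>] by metis
  define r where "r = min r1 (r2 / M)"
  have r: "0 < r" "r \<le> r1" "M * r \<le> r2"
    using r1 r2 M by (auto simp: r_def min_def field_simps)
  show ?thesis
  proof (intro exI[of _ r] conjI r(1) ballI)
    fix u assume u: "u \<in> K"
    hence uU: "u \<in> U" using K by blast
    define w where "w t x = \<phi> t (u + x) - \<phi> t u" for t x
    define R where "R t x = f (\<phi> t (u + x)) - f (\<phi> t u) - jacobian f (at (\<phi> t u)) *v w t x" for t x
    have xU: "u + x \<in> U" if "norm x \<le> r" for x using lip[of u "u + x" 0] that u r T by simp
    have wle: "norm (w t x) \<le> M * norm x" if "norm x \<le> r" "0 \<le> t" "t \<le> T" for t x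
      using lip[of u "u + x" t] that u r by (simp add: w_def)
    have Rle: "norm (R t x) \<le> \<eta> * M * norm x" if x: "norm x \<le> r" and t: "0 \<le> t" "t \<le> T" for t x
    proof -
      have "M * norm x \<le> M * r" using x M by (intro mult_left_mono) auto
      hence "norm (\<phi> t (u + x) - \<phi> t u) \<le> r2" using wle[OF x t] r unfolding w_def by linarith
      hence "norm (R t x) \<le> \<eta> * norm (w t x)"
        using lin[OF inv[OF t(1) u]] by (simp add: R_def w_def)
      also have "\<dots> \<le> \<eta> * (M * norm x)" using wle[OF x t] \<eta> by (intro mult_left_mono) auto
      finally show ?thesis by simp
    qed
    define a :: "'n \<Rightarrow> real^'n" where "a i = r *\<^sub>R axis i 1" for i
    have na: "norm (a i) = r" for i using r by (simp add: a_def)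
    \<comment> \<open>The columns are difference quotients of the time-\<open>T\<close> map with the
      fixed step \<open>r\<close> along the axes.\<close>
    define D where "D = (\<chi> j i. w T (a i) $ j / r)"
    have Dx: "D *v x = (\<Sum>i\<in>UNIV. (x $ i / r) *\<^sub>R w T (a i))" for x
      by (simp add: D_def vec_eq_iff matrix_vector_mult_def mult_ac)
    have "norm (w T x - D *v x) \<le> e * norm x" if x: "norm x \<le> r" for x
    proof -
      \<comment> \<open>The failure of linearity at time \<open>t\<close>. It starts at 0, since
        \<open>w 0\<close> is the identity on small vectors, and it solves the linearised equation
        up to the remainders \<open>R\<close>.\<close>
      define z where "z t = w t x - (\<Sum>i\<in>UNIV. (x $ i / r) *\<^sub>R w t (a i))" for t
      define z' where "z' t = (f (\<phi> t (u + x)) - f (\<phi> t u))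
          - (\<Sum>i\<in>UNIV. (x $ i / r) *\<^sub>R (f (\<phi> t (u + a i)) - f (\<phi> t u)))" for t
      define c where "c = \<eta> * M * (1 + n) * norm x"
      have xi: "u + a i \<in> U" for i using xU na by simp
      have fe: "f (\<phi> t (u + y)) - f (\<phi> t u) = jacobian f (at (\<phi> t u)) *v w t y + R t y" for t y
        by (simp add: R_def)
      have "(norm (z T))\<^sup>2 \<le> ((norm (z 0))\<^sup>2 + c\<^sup>2 * T) * exp ((2 * L + 1) * T)"
      proof (rule gronwall_norm_square[OF T L(1)])
        show "continuous_on {0..T} z"
          unfolding z_def w_def by (intro continuous_intros flow_continuous xi xU x uU)
        fix t assume t: "0 < t" "t < T"
        show "(z has_vector_derivative z' t) (at t)"
          unfolding z_def z'_def w_def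
          by (intro has_vector_derivative_diff has_vector_derivative_sum
              bounded_linear.has_vector_derivative[OF bounded_linear_scaleR_right]
              flow_deriv xi xU x uU t)
        have "z' t = jacobian f (at (\<phi> t u)) *v z t + (R t x - (\<Sum>i\<in>UNIV. (x $ i / r) *\<^sub>R R t (a i)))"
          unfolding z'_def fe z_def
          by (simp add: matrix_vector_mult_diff_distrib linear_sum[OF matrix_vector_mul_linear]
              matrix_vector_mult_scaleR scaleR_add_right sum.distrib)
        hence "norm (z' t) \<le> norm (jacobian f (at (\<phi> t u)) *v z t)
            + norm (R t x - (\<Sum>i\<in>UNIV. (x $ i / r) *\<^sub>R R t (a i)))"
          by (simp only: norm_triangle_ineq)
        also have "norm (jacobian f (at (\<phi> t u)) *v z t) \<le> L * norm (z t)"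
          using norm_matrix_vector_le[of "jacobian f (at (\<phi> t u))" "z t"] L(2)[OF inv[of t u]] u t
          by (smt (verit) mult_right_mono norm_ge_zero)
        also have "norm (R t x - (\<Sum>i\<in>UNIV. (x $ i / r) *\<^sub>R R t (a i)))
            \<le> norm (R t x) + (\<Sum>i\<in>UNIV. norm ((x $ i / r) *\<^sub>R R t (a i)))"
          by (intro order_trans[OF norm_triangle_ineq4] add_left_mono norm_sum)
        \<comment> \<open>The remainder along an axis has size \<open>\<eta> * M * r\<close>, and
          its coefficient \<open>x $ i / r\<close> turns this into at most
          \<open>\<eta> * M * norm x\<close>. With the remainder of \<open>x\<close> itself this
          makes 1 + n equal contributions.\<close>
        also have "\<dots> \<le> \<eta> * M * norm x + (\<Sum>i\<in>(UNIV :: 'n set). \<eta> * M * norm x)"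
        proof (intro add_mono sum_mono)
          show "norm (R t x) \<le> \<eta> * M * norm x" using Rle x t by simp
          fix i
          have "norm ((x $ i / r) *\<^sub>R R t (a i)) \<le> (\<bar>x $ i\<bar> / r) * (\<eta> * M * norm (a i))"
          proof -
            have "norm ((x $ i / r) *\<^sub>R R t (a i)) = (\<bar>x $ i\<bar> / r) * norm (R t (a i))" using r by simp
            also have "\<dots> \<le> (\<bar>x $ i\<bar> / r) * (\<eta> * M * norm (a i))"
              using Rle[of "a i" t] na[of i] t r by (intro mult_left_mono) auto
            finally show ?thesis .
          qed
          also have "\<dots> = \<bar>x $ i\<bar> * (\<eta> * M)" using r na by simp
          also have "\<dots> \<le> norm x * (\<eta> * M)"
            using \<eta> M by (intro mult_right_mono component_le_norm_cart) auto
          finally show "norm ((x $ i / r) *\<^sub>R R t (a i)) \<le> \<eta> * M * norm x" by (simp add: mult_ac)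
        qed
        also have "\<dots> = c" by (simp add: c_def n_def algebra_simps)
        finally show "norm (z' t) \<le> L * norm (z t) + c" by simp
      qed
      also have "z 0 = 0"
      proof -
        have "w 0 y = y" if "norm y \<le> r" for y using that by (simp add: w_def flow_0 xU uU)
        hence "z 0 = x - (\<Sum>i\<in>UNIV. (x $ i / r) *\<^sub>R a i)" using x na by (simp add: z_def)
        also have "(\<Sum>i\<in>UNIV. (x $ i / r) *\<^sub>R a i) = (\<Sum>i\<in>UNIV. x $ i *\<^sub>R axis i 1)"
          using r by (simp add: a_def)
        also have "\<dots> = x" using basis_expansion[of x] by (simp add: scalar_mult_eq_scaleR)
        finally show ?thesis by simp
      qed
      also have "((norm (0 :: real^'n))\<^sup>2 + c\<^sup>2 * T) * exp ((2 * L + 1) * T) \<le> c\<^sup>2 * G"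
        unfolding G_def by (simp add: mult.assoc mult_left_mono mult_right_mono)
      also have "\<dots> \<le> c\<^sup>2 * G\<^sup>2" using G by (intro mult_left_mono) (auto simp: power2_eq_square)
      finally have "(norm (z T))\<^sup>2 \<le> (c * G)\<^sup>2" by (simp add: power_mult_distrib)
      hence "norm (z T) \<le> c * G"
        by (rule power2_le_imp_le) (use \<eta> M n G in \<open>simp add: c_def\<close>)
      also have "c * G = e * norm x" using M n G by (simp add: c_def \<eta>_def)
      finally show ?thesis by (simp add: z_def Dx)
    qed
    thus "\<exists>D. \<forall>x. norm x \<le> r \<longrightarrow> norm (\<phi> T (u + x) - \<phi> T u - D *v x) \<le> e * norm x"
      unfolding w_def by blast
  qed
qed

lemma flow_C1:
  assumes "0 \<le> T"
  shows "\<forall>u\<in>K. \<phi> T differentiable at u" "continuous_on K (\<lambda>u. jacobian (\<phi> T) (at u))"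
  using C1_on_if_uniformly_approx_linear[OF flow_uniformly_approx_linear[OF assms]] by blast+

end

section \<open>Lyapunov dimension under conjugacy\<close>

lemma continuous_on_matrix_matrix_mult:
  fixes A :: "'a::topological_space \<Rightarrow> real^'n^'m" and B :: "'a \<Rightarrow> real^'k^'n"
  assumes "continuous_on S A" "continuous_on S B"
  shows "continuous_on S (\<lambda>x. A x ** B x)"
  unfolding matrix_matrix_mult_def
  by (intro continuous_on_vec_lambda continuous_intros continuous_on_component assms)

lemma jacobian_compose:
  fixes f :: "real^'m \<Rightarrow> real^'k" and g :: "real^'n \<Rightarrow> real^'m"
  assumes g: "g differentiable at x" and f: "f differentiable at (g x)"
  shows "(\<lambda>x. f (g x)) differentiable at x"
    and "jacobian (\<lambda>x. f (g x)) (at x) = jacobian f (at (g x)) ** jacobian g (at x)"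
proof -
  have "(f \<circ> g has_derivative (\<lambda>h. jacobian f (at (g x)) *v h) \<circ> (\<lambda>h. jacobian g (at x) *v h)) (at x)"
    using f g by (intro diff_chain_at) (simp_all add: jacobian_works[symmetric])
  hence D: "((\<lambda>x. f (g x)) has_derivative (\<lambda>h. (jacobian f (at (g x)) ** jacobian g (at x)) *v h)) (at x)"
    by (simp add: o_def matrix_vector_mul_assoc)
  show "(\<lambda>x. f (g x)) differentiable at x" using D by (rule differentiableI)
  show "jacobian (\<lambda>x. f (g x)) (at x) = jacobian f (at (g x)) ** jacobian g (at x)"
    using D by (rule jacobian_eqI)
qed

lemma jacobian_transform_open:
  fixes f g :: "real^'n \<Rightarrow> real^'m"
  assumes "f differentiable at x" "open U" "x \<in> U" "\<And>y. y \<in> U \<Longrightarrow> f y = g y"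
  shows "g differentiable at x" "jacobian g (at x) = jacobian f (at x)"
proof -
  have "(f has_derivative (\<lambda>h. jacobian f (at x) *v h)) (at x)"
    using assms(1) by (simp add: jacobian_works[symmetric])
  hence D: "(g has_derivative (\<lambda>h. jacobian f (at x) *v h)) (at x)"
    using assms(2-4) by (rule has_derivative_transform_within_open)
  show "g differentiable at x" using D by (rule differentiableI)
  show "jacobian g (at x) = jacobian f (at x)" using D by (rule jacobian_eqI)
qed

lemma continuously_differentiable_on_imp_continuous_on:
  "continuously_differentiable_on U f \<Longrightarrow> continuous_on U f"
  unfolding continuously_differentiable_on_def
  by (simp add: continuous_at_imp_continuous_on differentiable_imp_continuous_within)

lemma continuously_differentiable_on_cong:
  assumes f: "continuously_differentiable_on U f" and U: "open U"
    and eq: "\<And>y. y \<in> U \<Longrightarrow> f y = g y"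
  shows "continuously_differentiable_on U g"
  using f jacobian_transform_open[OF _ U _ eq]
  by (simp add: continuously_differentiable_on_def cong: continuous_on_cong)

lemma continuously_differentiable_on_compose:
  assumes g: "continuously_differentiable_on U g" "g ` U \<subseteq> V" and f: "continuously_differentiable_on V f"
  shows "continuously_differentiable_on U (\<lambda>x. f (g x))"
proof -
  have d: "g differentiable at x" "f differentiable at (g x)" if "x \<in> U" for x
    using that f g by (auto simp: continuously_differentiable_on_def)
  have "continuous_on U (\<lambda>x. jacobian f (at (g x)))"
    using f g continuously_differentiable_on_imp_continuous_on[OF g(1)]
    by (auto simp: continuously_differentiable_on_def intro: continuous_on_compose2)
  hence "continuous_on U (\<lambda>x. jacobian f (at (g x)) ** jacobian g (at x))"
    using g by (intro continuous_on_matrix_matrix_mult) (auto simp: continuously_differentiable_on_def)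
  thus ?thesis
    using jacobian_compose[OF d] by (simp add: continuously_differentiable_on_def cong: continuous_on_cong)
qed

section \<open>Bounds and comparison rules for the Lyapunov dimensions\<close>

lemma lyapunov_dim_at_bounds:
  fixes F :: "real^'n \<Rightarrow> real^'n"
  shows "0 \<le> lyapunov_dim_at F u" "lyapunov_dim_at F u \<le> real CARD('n)"
proof -
  let ?D = "{d \<in> {0..real CARD('n)}. singular_value_function d (jacobian F (at u)) < 1}"
  have "0 \<le> Inf ?D \<and> Inf ?D \<le> real CARD('n)" if ne: "?D \<noteq> {}"
  proof
    show "0 \<le> Inf ?D" using ne by (intro cInf_greatest) auto
    obtain d where "d \<in> ?D" using ne by blast
    thus "Inf ?D \<le> real CARD('n)" by (intro cInf_lower2[of d]) (auto intro!: bdd_belowI[of _ 0])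
  qed
  thus "0 \<le> lyapunov_dim_at F u" "lyapunov_dim_at F u \<le> real CARD('n)"
    unfolding lyapunov_dim_at_def Let_def by auto
qed

lemma lyapunov_dim_at_le:
  fixes F :: "real^'n \<Rightarrow> real^'n"
  assumes "0 \<le> d" "d \<le> real CARD('n)" "singular_value_function d (jacobian F (at u)) < 1"
  shows "lyapunov_dim_at F u \<le> d"
proof -
  let ?D = "{d \<in> {0..real CARD('n)}. singular_value_function d (jacobian F (at u)) < 1}"
  have "d \<in> ?D" using assms by simp
  moreover from this have "Inf ?D \<le> d" by (intro cInf_lower) (auto intro!: bdd_belowI[of _ 0])
  ultimately show ?thesis unfolding lyapunov_dim_at_def Let_def by auto
qed

text \<open>The infimum provides some \<open>c\<close> below \<open>d\<close> in the set, and upward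
  closedness carries this to \<open>d\<close>. The default value n for the empty set is excluded by
  \<open>d\<close> being at most n.\<close>

lemma lyapunov_dim_at_lessD:
  fixes F :: "real^'n \<Rightarrow> real^'n"
  assumes "lyapunov_dim_at F u < d" "d \<le> real CARD('n)"
  shows "singular_value_function d (jacobian F (at u)) < 1"
proof -
  let ?D = "{d \<in> {0..real CARD('n)}. singular_value_function d (jacobian F (at u)) < 1}"
  have ne: "?D \<noteq> {}" and "Inf ?D < d"
    using assms unfolding lyapunov_dim_at_def Let_def by (auto split: if_splits)
  then obtain c where c: "c \<in> ?D" "c < d" using cInf_lessD[OF ne] by blast
  show ?thesis
    by (rule singular_value_function_less_1_mono[of d c]) (use c assms in auto)
qed

context
  fixes F :: "real^'n \<Rightarrow> real^'n" and K :: "(real^'n) set"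
  assumes K: "K \<noteq> {}"
begin

lemma bdd_above_lyapunov_dim_at: "bdd_above ((\<lambda>u. lyapunov_dim_at F u) ` K)"
  by (rule bdd_aboveI[of _ "real CARD('n)"]) (auto simp: lyapunov_dim_at_bounds)

lemma lyapunov_dim_map_bounds: "0 \<le> lyapunov_dim_map F K" "lyapunov_dim_map F K \<le> real CARD('n)"
proof -
  obtain u where "u \<in> K" using K by blast
  thus "0 \<le> lyapunov_dim_map F K"
    unfolding lyapunov_dim_map_def
    by (intro cSUP_upper2[OF bdd_above_lyapunov_dim_at, of u] lyapunov_dim_at_bounds)
  show "lyapunov_dim_map F K \<le> real CARD('n)"
    unfolding lyapunov_dim_map_def by (intro cSUP_least K lyapunov_dim_at_bounds)
qed

lemma lyapunov_dim_map_lessD: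
  assumes "lyapunov_dim_map F K < d" "d \<le> real CARD('n)" "u \<in> K"
  shows "singular_value_function d (jacobian F (at u)) < 1"
proof (rule lyapunov_dim_at_lessD)
  have "lyapunov_dim_at F u \<le> lyapunov_dim_map F K"
    unfolding lyapunov_dim_map_def using assms(3) by (intro cSUP_upper bdd_above_lyapunov_dim_at)
  thus "lyapunov_dim_at F u < d" using assms(1) by simp
qed (rule assms)

lemma lyapunov_dim_map_le:
  assumes "0 \<le> d" "d \<le> real CARD('n)"
    and "\<And>u. u \<in> K \<Longrightarrow> singular_value_function d (jacobian F (at u)) < 1"
  shows "lyapunov_dim_map F K \<le> d"
  unfolding lyapunov_dim_map_def by (intro cSUP_least K lyapunov_dim_at_le assms)

end

lemma bdd_below_lyapunov_dim_map:
  "K \<noteq> {} \<Longrightarrow> bdd_below ((\<lambda>t. lyapunov_dim_map (\<phi> t) K) ` S)"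
  by (rule bdd_belowI[of _ 0]) (auto intro: lyapunov_dim_map_bounds)

text \<open>What both kinds of time share. It mentions neither a vector field nor a generating map,
  so it passes to the conjugate system. Times are positive, as in the dimension, and derivatives are
  taken on \<open>K\<close>, where the flow estimates provide them.\<close>

locale C1_semigroup =
  fixes U K :: "(real^'n) set" and T :: "real set" and \<phi> :: "real \<Rightarrow> real^'n \<Rightarrow> real^'n"
  assumes open_U: "open U" and K_subset: "K \<subseteq> U" and compact_K: "compact K" and K_nonempty: "K \<noteq> {}"
    and T_add: "\<And>s t. s \<in> T \<Longrightarrow> t \<in> T \<Longrightarrow> s + t \<in> T" and T_pos: "\<exists>t\<in>T. 0 < t"
    and maps: "\<And>t u. t \<in> T \<Longrightarrow> 0 < t \<Longrightarrow> u \<in> U \<Longrightarrow> \<phi> t u \<in> U"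
    and semigroup: "\<And>s t u. s \<in> T \<Longrightarrow> 0 < s \<Longrightarrow> t \<in> T \<Longrightarrow> 0 < t \<Longrightarrow> u \<in> U \<Longrightarrow> \<phi> (s + t) u = \<phi> s (\<phi> t u)"
    and inv: "\<And>t. t \<in> T \<Longrightarrow> 0 < t \<Longrightarrow> \<phi> t ` K = K"
    and diff: "\<And>t u. t \<in> T \<Longrightarrow> 0 < t \<Longrightarrow> u \<in> K \<Longrightarrow> \<phi> t differentiable at u"
    and cont: "\<And>t. t \<in> T \<Longrightarrow> 0 < t \<Longrightarrow> continuous_on K (\<lambda>u. jacobian (\<phi> t) (at u))"
begin

lemma inv_mem: "t \<in> T \<Longrightarrow> 0 < t \<Longrightarrow> u \<in> K \<Longrightarrow> \<phi> t u \<in> K"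
  using inv by blast

lemma Suc_mult_mem: "t \<in> T \<Longrightarrow> real (Suc m) * t \<in> T"
proof (induction m)
  case (Suc m)
  hence "t + real (Suc m) * t \<in> T" by (intro T_add) auto
  thus ?case by (simp add: distrib_right)
qed simp

lemma lyapunov_dim_le_CARD: "lyapunov_dim T \<phi> K \<le> real CARD('n)"
proof -
  obtain t where "t \<in> T" "0 < t" using T_pos by blast
  thus ?thesis unfolding lyapunov_dim_def
    by (intro cINF_lower2[OF bdd_below_lyapunov_dim_map, of _ t] lyapunov_dim_map_bounds K_nonempty) auto
qed

lemma lyapunov_dim_nonneg: "0 \<le> lyapunov_dim T \<phi> K"
  unfolding lyapunov_dim_def using T_pos
  by (intro cINF_greatest lyapunov_dim_map_bounds K_nonempty) auto

text \<open>Induction along an orbit, which stays in \<open>K\<close>, so every factor of the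
  cocycle is bounded by \<open>q\<close>. Using \<open>Suc m\<close> keeps the times
  positive.\<close>

lemma singular_value_function_power_le:
  assumes d: "0 \<le> d" "d \<le> real CARD('n)" and t: "t \<in> T" "0 < t" and q: "0 \<le> q"
    and le: "\<And>u. u \<in> K \<Longrightarrow> singular_value_function d (jacobian (\<phi> t) (at u)) \<le> q"
    and u: "u \<in> K"
  shows "singular_value_function d (jacobian (\<phi> (real (Suc m) * t)) (at u)) \<le> q ^ Suc m"
proof (induction m)
  case 0 show ?case using le[OF u] by simp
next
  case (Suc m)
  define s where "s = real (Suc m) * t"
  have s: "s \<in> T" "0 < s" using Suc_mult_mem t by (auto simp: s_def)
  have fs: "\<phi> s u \<in> K" using inv_mem[OF s u] .
  have "real (Suc (Suc m)) * t = t + s" by (simp add: s_def distrib_right)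
  moreover have "jacobian (\<phi> (t + s)) (at u) = jacobian (\<phi> t) (at (\<phi> s u)) ** jacobian (\<phi> s) (at u)"
  proof -
    note c = jacobian_compose[OF diff[OF s u] diff[OF t fs]]
    show ?thesis
      using jacobian_transform_open(2)[OF c(1) open_U, of "\<phi> (t + s)"] semigroup[OF t s] u K_subset c(2)
      by auto
  qed
  ultimately have "singular_value_function d (jacobian (\<phi> (real (Suc (Suc m)) * t)) (at u))
      \<le> singular_value_function d (jacobian (\<phi> t) (at (\<phi> s u))) * singular_value_function d (jacobian (\<phi> s) (at u))"
    using singular_value_function_mult_le[OF d] by metis
  also have "\<dots> \<le> q * q ^ Suc m"
    using Suc le[OF fs] q by (intro mult_mono) (auto simp: s_def singular_value_function_nonneg[OF d])
  finally show ?case by simp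
qed

end

text \<open>The inverse \<open>g\<close> is an explicit parameter, so that the locale can be
  instantiated a second time with \<open>h\<close> and \<open>g\<close> exchanged.\<close>

locale conjugate_C1_semigroup = C1_semigroup +
  fixes h g :: "real^'n \<Rightarrow> real^'n" and \<psi> :: "real \<Rightarrow> real^'n \<Rightarrow> real^'n"
  assumes open_hU: "open (h ` U)"
    and gh: "\<And>u. u \<in> U \<Longrightarrow> g (h u) = u"
    and C1_h: "continuously_differentiable_on U h"
    and C1_g: "continuously_differentiable_on (h ` U) g"
    and conj: "\<And>t u. t \<in> T \<Longrightarrow> u \<in> U \<Longrightarrow> \<psi> t (h u) = h (\<phi> t u)"
begin

lemma jacobian_conjugate:
  assumes t: "t \<in> T" "0 < t" and u: "u \<in> K"
  shows "\<psi> t differentiable at (h u)"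
    and "jacobian (\<psi> t) (at (h u)) = jacobian h (at (\<phi> t u)) ** (jacobian (\<phi> t) (at u) ** jacobian g (at (h u)))"
proof -
  have uU: "u \<in> U" and fU: "\<phi> t u \<in> U" using u K_subset inv_mem[OF t u] by auto
  have dg: "g differentiable at (h u)" and dh: "h differentiable at (\<phi> t u)"
    using C1_g C1_h uU fU by (auto simp: continuously_differentiable_on_def)
  have df: "\<phi> t differentiable at (g (h u))" using diff[OF t u] gh[OF uU] by simp
  note c1 = jacobian_compose[OF dg df]
  have "h differentiable at (\<phi> t (g (h u)))" using dh gh[OF uU] by simp
  note c2 = jacobian_compose[OF c1(1) this]
  have eq: "h (\<phi> t (g v)) = \<psi> t v" if "v \<in> h ` U" for v
    using that gh conj t by auto
  note tr = jacobian_transform_open[OF c2(1) open_hU _ eq]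
  show "\<psi> t differentiable at (h u)" using tr(1) uU by blast
  show "jacobian (\<psi> t) (at (h u)) = jacobian h (at (\<phi> t u)) ** (jacobian (\<phi> t) (at u) ** jacobian g (at (h u)))"
    using tr(2) uU c2(2) c1(2) gh[OF uU] by auto
qed

lemma conjugate_is_C1_semigroup: "C1_semigroup (h ` U) (h ` K) T \<psi>"
proof
  show "compact (h ` K)"
    using continuously_differentiable_on_imp_continuous_on[OF C1_h] K_subset compact_K
    by (blast intro: compact_continuous_image continuous_on_subset)
  show "\<psi> t ` h ` K = h ` K" if t: "t \<in> T" "0 < t" for t
  proof -
    have "\<psi> t ` h ` K = h ` \<phi> t ` K"
      unfolding image_image using K_subset conj[OF t(1)] by (intro image_cong) auto
    thus ?thesis using inv[OF t] by simp
  qed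
  show "continuous_on (h ` K) (\<lambda>v. jacobian (\<psi> t) (at v))" if t: "t \<in> T" "0 < t" for t
  proof -
    have hK: "h ` K \<subseteq> h ` U" using K_subset by blast
    have cg: "continuous_on (h ` K) g"
      using continuously_differentiable_on_imp_continuous_on[OF C1_g] hK by (rule continuous_on_subset)
    have gK: "g ` h ` K \<subseteq> K" using gh K_subset by auto
    have cphi: "continuous_on K (\<phi> t)"
      using diff[OF t] by (simp add: continuous_at_imp_continuous_on differentiable_imp_continuous_within)
    have "continuous_on (h ` K) (\<lambda>v. jacobian h (at (\<phi> t (g v))) ** (jacobian (\<phi> t) (at (g v)) ** jacobian g (at v)))"
    proof (intro continuous_on_matrix_matrix_mult)
      show "continuous_on (h ` K) (\<lambda>v. jacobian g (at v))"
        using C1_g hK by (auto simp: continuously_differentiable_on_def intro: continuous_on_subset)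
      show "continuous_on (h ` K) (\<lambda>v. jacobian (\<phi> t) (at (g v)))"
        by (rule continuous_on_compose2[OF cont[OF t] cg gK])
      have cpg: "continuous_on (h ` K) (\<lambda>v. \<phi> t (g v))"
        by (rule continuous_on_compose2[OF cphi cg gK])
      have cJ: "continuous_on U (\<lambda>v. jacobian h (at v))"
        using C1_h by (simp add: continuously_differentiable_on_def)
      have sub: "(\<lambda>v. \<phi> t (g v)) ` h ` K \<subseteq> U" using gK inv_mem[OF t] K_subset by blast
      show "continuous_on (h ` K) (\<lambda>v. jacobian h (at (\<phi> t (g v))))"
        by (rule continuous_on_compose2[OF cJ cpg sub])
    qed
    moreover have "jacobian h (at (\<phi> t (g v))) ** (jacobian (\<phi> t) (at (g v)) ** jacobian g (at v))
        = jacobian (\<psi> t) (at v)" if "v \<in> h ` K" for v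
      using that jacobian_conjugate(2)[OF t] gh K_subset by auto
    ultimately show ?thesis by (simp cong: continuous_on_cong)
  qed
qed (use open_hU K_subset K_nonempty T_add T_pos conj maps semigroup jacobian_conjugate(1) in
    \<open>auto simp: image_iff\<close>)

lemma lyapunov_dim_conjugate_le: "lyapunov_dim T \<psi> (h ` K) \<le> lyapunov_dim T \<phi> K"
proof (rule dense_ge)
  fix d assume less: "lyapunov_dim T \<phi> K < d"
  interpret \<psi>: C1_semigroup "h ` U" "h ` K" T \<psi> by (rule conjugate_is_C1_semigroup)
  show "lyapunov_dim T \<psi> (h ` K) \<le> d"
  proof (cases "d \<le> real CARD('n)")
    \<comment> \<open>The singular value function is meaningful only up to n, but the dimension
      never exceeds n.\<close>
    case False
    thus ?thesis using \<psi>.lyapunov_dim_le_CARD by simp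
  next
    case dn: True
    have d: "0 \<le> d" using less lyapunov_dim_nonneg by simp
    let ?\<omega> = "singular_value_function d :: real^'n^'n \<Rightarrow> real"
    note nonneg = singular_value_function_nonneg[OF d dn]
    obtain t where t: "t \<in> T" "0 < t" "lyapunov_dim_map (\<phi> t) K < d"
      using cInf_lessD[OF _ less[unfolded lyapunov_dim_def]] T_pos by auto
    obtain q where q: "0 \<le> q" "q < 1" "\<And>u. u \<in> K \<Longrightarrow> ?\<omega> (jacobian (\<phi> t) (at u)) \<le> q"
    proof -
      have "continuous_on K (\<lambda>u. ?\<omega> (jacobian (\<phi> t) (at u)))"
        by (rule continuous_on_singular_value_function[OF d dn cont[OF t(1,2)]])
      from continuous_attains_sup[OF compact_K K_nonempty this]
      obtain u where "u \<in> K" "\<forall>v\<in>K. ?\<omega> (jacobian (\<phi> t) (at v)) \<le> ?\<omega> (jacobian (\<phi> t) (at u))" by blast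
      thus ?thesis using that[of "?\<omega> (jacobian (\<phi> t) (at u))"] nonneg
          lyapunov_dim_map_lessD[OF K_nonempty t(3) dn] by blast
    qed
    have bound: "\<exists>C. \<forall>x\<in>L. ?\<omega> (M x) \<le> C" if "compact L" "continuous_on L M" for L and M :: "real^'n \<Rightarrow> real^'n^'n"
    proof -
      have "bounded ((\<lambda>x. ?\<omega> (M x)) ` L)"
        by (intro compact_imp_bounded compact_continuous_image that
            continuous_on_singular_value_function[OF d dn])
      then obtain C where "\<forall>x\<in>(\<lambda>x. ?\<omega> (M x)) ` L. norm x \<le> C" unfolding bounded_iff by blast
      thus ?thesis by (intro exI[of _ C]) auto
    qed
    have "continuous_on K (\<lambda>u. jacobian h (at u))"
      using C1_h K_subset by (auto simp: continuously_differentiable_on_def intro: continuous_on_subset)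
    from bound[OF compact_K this]
    obtain C1 where C1: "\<And>u. u \<in> K \<Longrightarrow> ?\<omega> (jacobian h (at u)) \<le> C1" by blast
    have "continuous_on (h ` K) (\<lambda>u. jacobian g (at u))"
      using C1_g \<psi>.K_subset by (auto simp: continuously_differentiable_on_def intro: continuous_on_subset)
    from bound[OF \<psi>.compact_K this]
    obtain C2 where C2: "\<And>v. v \<in> h ` K \<Longrightarrow> ?\<omega> (jacobian g (at v)) \<le> C2" by blast
    have C0: "0 \<le> C1" "0 \<le> C2" using K_nonempty C1 C2 nonneg by (meson order_trans ex_in_conv imageI)+
    \<comment> \<open>The summand 1 keeps the denominator positive when a constant is 0, and it
      absorbs the passage to the target inequality at exponent \<open>m\<close>.\<close>
    obtain m where m: "q ^ m < 1 / (C1 * C2 + 1)"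
      using real_arch_pow_inv[of "1 / (C1 * C2 + 1)" q] C0 q by (auto simp: add_nonneg_pos)
    define s where "s = real (Suc m) * t"
    have s: "s \<in> T" "0 < s" using Suc_mult_mem t by (auto simp: s_def)
    have "lyapunov_dim_map (\<psi> s) (h ` K) \<le> d"
    proof (rule lyapunov_dim_map_le[OF \<psi>.K_nonempty d dn])
      fix v assume "v \<in> h ` K"
      then obtain u where u: "u \<in> K" "v = h u" by blast
      have "?\<omega> (jacobian (\<psi> s) (at v))
          \<le> ?\<omega> (jacobian h (at (\<phi> s u))) * ?\<omega> (jacobian (\<phi> s) (at u) ** jacobian g (at v))"
        unfolding u(2) jacobian_conjugate(2)[OF s u(1)] by (rule singular_value_function_mult_le[OF d dn])
      also have "\<dots> \<le> ?\<omega> (jacobian h (at (\<phi> s u))) * (?\<omega> (jacobian (\<phi> s) (at u)) * ?\<omega> (jacobian g (at v)))"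
        by (intro mult_left_mono singular_value_function_mult_le[OF d dn] nonneg)
      also have "\<dots> \<le> C1 * (q ^ Suc m * C2)"
        using C1[OF inv_mem[OF s u(1)]] C2[of v] C0 q(1) u(1) \<open>v \<in> h ` K\<close>
          singular_value_function_power_le[OF d dn t(1,2) q(1,3) u(1), of m]
        unfolding s_def by (intro mult_mono mult_nonneg_nonneg nonneg zero_le_power) auto
      also have "\<dots> \<le> (C1 * C2 + 1) * q ^ m"
      proof -
        have "q ^ Suc m \<le> q ^ m" using q by (intro power_decreasing) auto
        hence "(C1 * C2) * q ^ Suc m \<le> (C1 * C2) * q ^ m" using C0 by (intro mult_left_mono) auto
        moreover have "C1 * (q ^ Suc m * C2) = (C1 * C2) * q ^ Suc m" by (simp only: mult_ac)
        moreover have "(C1 * C2 + 1) * q ^ m = (C1 * C2) * q ^ m + q ^ m" by (simp only: distrib_right mult_1)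
        ultimately show ?thesis using zero_le_power[OF q(1), of m] by linarith
      qed
      also have "\<dots> < 1"
      proof -
        have "0 < C1 * C2 + 1" using C0 by (simp add: add_nonneg_pos)
        thus ?thesis using m by (simp add: pos_less_divide_eq mult.commute)
      qed
      finally show "?\<omega> (jacobian (\<psi> s) (at v)) < 1" .
    qed
    thus ?thesis unfolding lyapunov_dim_def using s
      by (intro cINF_lower2[OF bdd_below_lyapunov_dim_map[OF \<psi>.K_nonempty], of s]) auto
  qed
qed

end

section \<open>Continuous and discrete time systems as instances\<close>

lemma continuous_time_C1_semigroup:
  fixes U K :: "(real^'n) set"
  assumes U: "open U" and K: "K \<subseteq> U" "K \<noteq> {}" "compact K" and sys: "continuous_time_system U \<phi>"
    and inv: "invariant_set {0..} \<phi> K"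
  shows "C1_semigroup U K {0..} \<phi>"
proof -
  obtain f where f: "continuously_differentiable_on U f"
    and sol: "\<And>u. u \<in> U \<Longrightarrow> forward_solution U f u (\<lambda>t. \<phi> t u)"
    and unique: "\<And>u v t. u \<in> U \<Longrightarrow> forward_solution U f u v \<Longrightarrow> 0 \<le> t \<Longrightarrow> v t = \<phi> t u"
    using sys unfolding continuous_time_system_def by blast
  have maps: "\<phi> t u \<in> U" if "u \<in> U" "0 \<le> t" for u t
    using sol[OF that(1)] that(2) by (simp add: forward_solution_def)
  \<comment> \<open>The flow lemmas use invariance from time 0 on, while
    \<open>invariant_set\<close> speaks of positive times; time 0 comes from the initial
    condition.\<close>
  have inv': "\<phi> t u \<in> K" if "0 \<le> t" "u \<in> K" for t u
  proof (cases "t = 0")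
    case True
    have "u \<in> U" using that K by blast
    thus ?thesis using sol[of u] True that by (simp add: forward_solution_def)
  next
    case False
    hence "\<phi> t ` K = K" using inv that by (simp add: invariant_set_def)
    thus ?thesis using that(2) by blast
  qed
  \<comment> \<open>The orbit shifted by \<open>t\<close> is again a forward solution, starting at
    \<open>\<phi> t u\<close>; uniqueness identifies it with the orbit of that point.\<close>
  have semigroup: "\<phi> (s + t) u = \<phi> s (\<phi> t u)" if st: "0 \<le> s" "0 \<le> t" and u: "u \<in> U" for s t u
  proof (rule unique[where v = "\<lambda>r. \<phi> (r + t) u"])
    show "forward_solution U f (\<phi> t u) (\<lambda>r. \<phi> (r + t) u)"
      unfolding forward_solution_def
    proof (intro conjI allI impI)
      fix r :: real assume r: "0 \<le> r"
      have "((\<lambda>x. \<phi> x u) has_vector_derivative f (\<phi> (r + t) u)) (at (r + t) within {0..})"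
        using sol[OF u] r st by (simp add: forward_solution_def)
      hence "((\<lambda>x. \<phi> x u) has_vector_derivative f (\<phi> (r + t) u)) (at (r + t) within (\<lambda>r. r + t) ` {0..})"
        by (rule has_vector_derivative_within_subset) (use st in auto)
      moreover have "((\<lambda>r. r + t) has_vector_derivative 1) (at r within {0..})"
        by (auto intro!: derivative_eq_intros)
      ultimately have "((\<lambda>x. \<phi> x u) \<circ> (\<lambda>r. r + t) has_vector_derivative 1 *\<^sub>R f (\<phi> (r + t) u)) (at r within {0..})"
        by (intro vector_diff_chain_within)
      thus "((\<lambda>r. \<phi> (r + t) u) has_vector_derivative f (\<phi> (r + t) u)) (at r within {0..})"
        by (simp add: o_def)
    qed (use maps u st in auto)
  qed (use maps u st in auto)
  note C1 = flow_C1[OF U K(3,1) f sol inv']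
  show ?thesis
  proof
    show "\<exists>t\<in>{0..}. 0 < (t :: real)" by (intro bexI[of _ 1]) auto
    show "\<phi> t ` K = K" if "t \<in> {0..}" "0 < t" for t using inv that by (simp add: invariant_set_def)
    show "\<phi> t differentiable at u" if "t \<in> {0..}" "0 < t" "u \<in> K" for t u
      using C1(1) that by simp
    show "continuous_on K (\<lambda>u. jacobian (\<phi> t) (at u))" if "t \<in> {0..}" "0 < t" for t
      using C1(2) that by simp
  qed (use U K maps semigroup in auto)
qed

lemma discrete_time_C1_semigroup:
  fixes U K :: "(real^'n) set"
  assumes U: "open U" and K: "K \<subseteq> U" "K \<noteq> {}" "compact K" and sys: "discrete_time_system U \<phi>"
    and inv: "invariant_set \<nat> \<phi> K"
  shows "C1_semigroup U K \<nat> \<phi>"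
proof -
  obtain g where g: "continuously_differentiable_on U g" "g ` U \<subseteq> U"
    and phi: "\<And>k u. u \<in> U \<Longrightarrow> \<phi> (real k) u = (g ^^ k) u"
    using sys unfolding discrete_time_system_def by blast
  have maps: "(g ^^ k) u \<in> U" if "u \<in> U" for k u
    using that g(2) by (induction k) auto
  have "continuously_differentiable_on U (g ^^ k)" for k
  proof (induction k)
    case 0
    have "((\<lambda>x. x) has_derivative (\<lambda>h. mat 1 *v h)) (at x)" for x :: "real^'n" by simp
    hence "jacobian (\<lambda>x. x) (at x) = mat 1" for x :: "real^'n" by (rule jacobian_eqI)
    thus ?case by (simp add: continuously_differentiable_on_def id_def)
  next
    case (Suc k)
    have "(g ^^ k) ` U \<subseteq> U" using maps by blast
    from continuously_differentiable_on_compose[OF Suc this g(1)]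
    show ?case by (simp add: o_def)
  qed
  hence C1: "continuously_differentiable_on U (\<phi> (real k))" for k
    by (rule continuously_differentiable_on_cong) (use U phi in auto)
  show ?thesis
  proof
    show "\<exists>t\<in>\<nat>. 0 < (t :: real)" by (intro bexI[of _ 1]) auto
    show "\<phi> t u \<in> U" if "t \<in> \<nat>" "u \<in> U" for t u
      using that by (auto elim!: Nats_cases simp: phi maps)
    show "\<phi> (s + t) u = \<phi> s (\<phi> t u)" if st: "s \<in> \<nat>" "t \<in> \<nat>" and u: "u \<in> U" for s t u
    proof -
      obtain j k where "s = real j" "t = real k" using st by (metis Nats_cases)
      thus ?thesis using u phi maps phi[of u "j + k"] by (simp add: funpow_add)
    qed
    show "\<phi> t ` K = K" if "t \<in> \<nat>" "0 < t" for t using inv that by (simp add: invariant_set_def)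
    show "\<phi> t differentiable at u" if "t \<in> \<nat>" "u \<in> K" for t u
      using that C1 K by (auto elim!: Nats_cases simp: continuously_differentiable_on_def)
    show "continuous_on K (\<lambda>u. jacobian (\<phi> t) (at u))" if "t \<in> \<nat>" for t
      using that C1 K
      by (auto elim!: Nats_cases simp: continuously_differentiable_on_def intro: continuous_on_subset)
  qed (use U K in auto)
qed

theorem proposition2:
  fixes U K :: "(real ^ 'n) set"
    and T :: "real set"
    and \<phi> \<phi>h :: "real \<Rightarrow> real ^ 'n \<Rightarrow> real ^ 'n"
    and h :: "real ^ 'n \<Rightarrow> real ^ 'n"
  assumes "smooth_dynamical_system U T \<phi>"
    and "K \<subseteq> U" and "K \<noteq> {}" and "compact K" and "invariant_set T \<phi> K"
    and "diffeomorphism_on U h"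
    and "\<forall>t\<in>T. \<forall>u\<in>U. \<phi>h t (h u) = h (\<phi> t u)"
  shows "lyapunov_dim T \<phi> K = lyapunov_dim T \<phi>h (h ` K)"
proof -
  have U: "open U" using assms(1) by (simp add: smooth_dynamical_system_def)
  have T: "T = {0..} \<and> continuous_time_system U \<phi> \<or> T = \<nat> \<and> discrete_time_system U \<phi>"
    using assms(1) by (simp add: smooth_dynamical_system_def)
  have semi: "C1_semigroup U K T \<phi>"
    using T continuous_time_C1_semigroup[OF U assms(2,3,4)] discrete_time_C1_semigroup[OF U assms(2,3,4)]
      assms(5) by blast
  have inj: "inj_on h U" and h: "continuously_differentiable_on U h"
    and g: "continuously_differentiable_on (h ` U) (inv_into U h)"
    using assms(6) by (auto simp: diffeomorphism_on_def)
  have open_hU: "open (h ` U)"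
    using continuously_differentiable_on_imp_continuous_on[OF h] U inj by (rule invariance_of_domain)
  interpret C: conjugate_C1_semigroup U K T \<phi> h "inv_into U h" \<phi>h
    using semi by (rule conjugate_C1_semigroup.intro)
      (unfold_locales, use open_hU inj h g assms(7) in auto)
  have im: "inv_into U h ` h ` U = U" "inv_into U h ` h ` K = K"
    using inj assms(2) by (auto simp: image_image subset_eq)
  \<comment> \<open>The conjugacy relation ranges over all times, including 0, where the locale
    gives nothing. To invert \<open>h\<close> in it, the image point has to be in \<open>U\<close>
    at time 0 too.\<close>
  have maps0: "\<phi> t u \<in> U" if "t \<in> T" "u \<in> U" for t u
  proof (cases "0 < t")
    case False
    have t: "t = 0" using T that(1) False by (auto elim!: Nats_cases)
    have "\<phi> 0 u = u"
      using T
    proof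
      assume "T = {0..} \<and> continuous_time_system U \<phi>"
      thus ?thesis using that(2) by (auto simp: continuous_time_system_def forward_solution_def)
    next
      assume "T = \<nat> \<and> discrete_time_system U \<phi>"
      then obtain k where "\<forall>n. \<forall>u\<in>U. \<phi> (real n) u = (k ^^ n) u"
        by (auto simp: discrete_time_system_def)
      from spec[OF this, of 0] show ?thesis using that(2) by simp
    qed
    thus ?thesis using t that by simp
  qed (use C.maps that in auto)
  interpret D: conjugate_C1_semigroup "h ` U" "h ` K" T \<phi>h "inv_into U h" h \<phi>
    using C.conjugate_is_C1_semigroup
  proof (rule conjugate_C1_semigroup.intro, unfold_locales)
    show "\<phi> t (inv_into U h v) = inv_into U h (\<phi>h t v)" if "t \<in> T" "v \<in> h ` U" for t v
      using that maps0 assms(7) inj by auto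
  qed (use im U h g inj in auto)
  show ?thesis
    using C.lyapunov_dim_conjugate_le D.lyapunov_dim_conjugate_le im by simp
qed

end
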